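(* Let $(X,d)$ be a compact metric space and let $F$ be a non-empty compact subset of $X$. Consider the following two conditions on $F$, for some constants $a>0$ and $r_0>0$: (Q1) for every set $U\subseteq X$ that intersects $F$ with $0<|U|\leq r_0$, there is a mapping $g:F\cap U\to F$ satisfying $a\,|U|^{-1}\,d(x,y)\leq d(g(x),g(y))$ for all $x,y\in F\cap U$; (Q2) for every closed ball $B$ with centre in $F$ and radius $r\leq r_0$, there is a mapping $g:F\to F\cap B$ satisfying $a\,r\,d(x,y)\leq d(g(x),g(y))$ for all $x,y\in F$. Then: (1) If $F$ satisfies (Q1) for some $a,r_0>0$, then \[ \dim_{\mathrm L}F\leq\dim_{\mathrm H}F=\dim_{\mathrm P}F=\dim_{\mathrm B}F=\dim_{\mathrm A}F. \] (2) If $F$ satisfies (Q2) for some $a,r_0>0$, then \[ \dim_{\mathrm L}F=\dim_{\mathrm H}F=\dim_{\mathrm P}F=\dim_{\mathrm B}F\leq\dim_{\mathrm A}F. \] (3) If $F$ satisfies (Q1) and (Q2) for some $a,r_0>0$, then \[ \dim_{\mathrm L}F=\dim_{\mathrm H}F=\dim_{\mathrm P}F=\dim_{\mathrm B}F=\dim_{\mathrm A}F \] and, moreover, $F$ is Ahlfors regular.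
   Context: $|U|$ denotes the diameter of $U$. $\dim_{\mathrm H}$, $\dim_{\mathrm P}$ are Hausdorff and packing dimension; $\dim_{\mathrm B}$ is the box dimension, i.e. the common value of the lower and upper box dimensions (the assertions include that these coincide). $\mathcal H^s$ is $s$-dimensional Hausdorff measure. A compact metric space $F$ is Ahlfors regular if $s:=\dim_{\mathrm H}F<\infty$ and there is $\lambda>0$ with $\lambda^{-1}r^{s}\leq\mathcal H^{s}(B(x,r)\cap F)\leq\lambda r^{s}$ for all $x\in F$ and all $0<r<\mathrm{diam}(F)$. For $r>0$, $N_r(F)$ denotes the smallest number of open sets of diameter at most $r$ needed to cover $F$, $B(x,R)$ is the closed ball, and \[ \dim_{\mathrm A}F=\inf\Big\{\alpha:\ \exists\, C,\rho>0 \text{ such that for all } 0<r<R\leq\rho,\ \sup_{x\in F}N_r(B(x,R)\cap F)\leq C (R/r)^{\alpha}\Big\}, \] \[ \dim_{\mathrm L}F=\sup\Big\{\alpha:\ \exists\, C,\rho>0 \text{ such that for all } 0<r<R\leq\rho,\ \inf_{x\in F}N_r(B(x,R)\cap F)\geq C (R/r)^{\alpha}\Big\}. \] *)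

theory Defs
  imports "HOL-Analysis.Analysis"
begin

text \<open>
  A compact metric space is represented by a compact set \<open>X\<close> in a type of class
  \<^class>\<open>metric_space\<close>. Open sets of the space are relatively open subsets of \<open>X\<close> and
  closed balls of the space are traces \<open>cball x r \<inter> X\<close>. Dimensions take values in
  \<^typ>\<open>ereal\<close>, because they may be infinite.
\<close>

text \<open>
  The summand \<open>|U|\<^sup>s\<close> of a cover. With the usual convention, every nonempty set (also a
  singleton) contributes \<open>1\<close> if \<open>s = 0\<close>, so that the \<open>0\<close>-dimensional measure counts points;
  this is not what \<^term>\<open>(0::real) powr 0\<close> gives.
\<close>

definition diam_pow :: "real \<Rightarrow> 'a::metric_space set \<Rightarrow> ennreal" where
  "diam_pow s U =
     (if U = {} then 0 else if s = 0 then 1 else ennreal (diameter U powr s))"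

text \<open>The covering sets are required to be bounded since \<^const>\<open>diameter\<close> is
  unspecified on unbounded sets.\<close>

definition hausdorff_premeasure :: "real \<Rightarrow> real \<Rightarrow> 'a::metric_space set \<Rightarrow> ennreal" where
  "hausdorff_premeasure s \<delta> A =
     (INF U\<in>{U :: nat \<Rightarrow> 'a set. A \<subseteq> (\<Union>i. U i) \<and> (\<forall>i. bounded (U i) \<and> diameter (U i) \<le> \<delta>)}.
        (\<Sum>i. diam_pow s (U i)))"

definition hausdorff_measure :: "real \<Rightarrow> 'a::metric_space set \<Rightarrow> ennreal" where
  "hausdorff_measure s A = (SUP \<delta>\<in>{0<..}. hausdorff_premeasure s \<delta> A)"

definition hausdorff_dim :: "'a::metric_space set \<Rightarrow> ereal" where
  "hausdorff_dim F = Inf (ereal ` {s. 0 \<le> s \<and> hausdorff_measure s F = 0})"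

text \<open>
  A \<open>\<delta>\<close>-packing of \<open>A\<close> is a countable family of pairwise disjoint closed balls of \<open>X\<close>
  with centres in \<open>A\<close> and radii at most \<open>\<delta>\<close>. It is encoded by its (centre, radius) pairs,
  and a ball of radius \<open>r\<close> has weight \<open>(2 r)\<^sup>s\<close>, as is standard in general metric spaces,
  where a ball need not determine its radius and its diameter may be smaller than \<open>2 r\<close>.
\<close>

definition packings :: "'a::metric_space set \<Rightarrow> real \<Rightarrow> 'a set \<Rightarrow> ('a \<times> real) set set" where
  "packings X \<delta> A =
     {P. countable P \<and> (\<forall>(x, r)\<in>P. x \<in> A \<and> 0 < r \<and> r \<le> \<delta>) \<and>
         pairwise (\<lambda>(x, r) (y, t). disjnt (cball x r \<inter> X) (cball y t \<inter> X)) P}"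

definition packing_premeasure :: "'a::metric_space set \<Rightarrow> real \<Rightarrow> 'a set \<Rightarrow> ennreal" where
  "packing_premeasure X s A =
     (INF \<delta>\<in>{0<..}. SUP P\<in>packings X \<delta> A. (\<Sum>\<^sub>\<infinity>(x, r)\<in>P. ennreal ((2 * r) powr s)))"

definition packing_measure :: "'a::metric_space set \<Rightarrow> real \<Rightarrow> 'a set \<Rightarrow> ennreal" where
  "packing_measure X s A =
     (INF E\<in>{E :: nat \<Rightarrow> 'a set. A \<subseteq> (\<Union>i. E i) \<and> (\<forall>i. E i \<subseteq> X)}.
        (\<Sum>i. packing_premeasure X s (E i)))"

definition packing_dim :: "'a::metric_space set \<Rightarrow> 'a set \<Rightarrow> ereal" where
  "packing_dim X F = Inf (ereal ` {s. 0 \<le> s \<and> packing_measure X s F = 0})"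

text \<open>For \<open>r > 0\<close> and a subset \<open>A\<close> of the compact set \<open>X\<close> finite covers as below always
  exist, so the minimum is over a nonempty set of natural numbers.\<close>

definition covering_number :: "'a::metric_space set \<Rightarrow> real \<Rightarrow> 'a set \<Rightarrow> nat" where
  "covering_number X r A =
     (LEAST n. \<exists>\<U>. finite \<U> \<and> card \<U> = n \<and> A \<subseteq> \<Union>\<U> \<and>
        (\<forall>U\<in>\<U>. openin (top_of_set X) U \<and> diameter U \<le> r))"

definition lower_box_dim :: "'a::metric_space set \<Rightarrow> 'a set \<Rightarrow> ereal" where
  "lower_box_dim X F =
     Liminf (at_right 0) (\<lambda>\<delta>. ereal (ln (real (covering_number X \<delta> F)) / (- ln \<delta>)))"

definition upper_box_dim :: "'a::metric_space set \<Rightarrow> 'a set \<Rightarrow> ereal" where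
  "upper_box_dim X F =
     Limsup (at_right 0) (\<lambda>\<delta>. ereal (ln (real (covering_number X \<delta> F)) / (- ln \<delta>)))"

definition assouad_dim :: "'a::metric_space set \<Rightarrow> 'a set \<Rightarrow> ereal" where
  "assouad_dim X F = Inf (ereal ` {\<alpha>. \<exists>C>0. \<exists>\<rho>>0. \<forall>r R. 0 < r \<and> r < R \<and> R \<le> \<rho> \<longrightarrow>
     (SUP x\<in>F. ereal (covering_number X r (cball x R \<inter> F))) \<le> ereal (C * (R / r) powr \<alpha>)})"

definition lower_dim :: "'a::metric_space set \<Rightarrow> 'a set \<Rightarrow> ereal" where
  "lower_dim X F = Sup (ereal ` {\<alpha>. \<exists>C>0. \<exists>\<rho>>0. \<forall>r R. 0 < r \<and> r < R \<and> R \<le> \<rho> \<longrightarrow>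
     (INF x\<in>F. ereal (covering_number X r (cball x R \<inter> F))) \<ge> ereal (C * (R / r) powr \<alpha>)})"

definition ahlfors_regular :: "'a::metric_space set \<Rightarrow> bool" where
  "ahlfors_regular F \<longleftrightarrow> compact F \<and> hausdorff_dim F < \<infinity> \<and>
     (let s = real_of_ereal (hausdorff_dim F) in
      \<exists>c>0. \<forall>x\<in>F. \<forall>r. 0 < r \<and> r < diameter F \<longrightarrow>
        ennreal (inverse c * r powr s) \<le> hausdorff_measure s (cball x r \<inter> F) \<and>
        hausdorff_measure s (cball x r \<inter> F) \<le> ennreal (c * r powr s))"

definition Q1 :: "'a::metric_space set \<Rightarrow> 'a set \<Rightarrow> real \<Rightarrow> real \<Rightarrow> bool" where
  "Q1 X F a r0 \<longleftrightarrow>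
     (\<forall>U. U \<subseteq> X \<and> U \<inter> F \<noteq> {} \<and> 0 < diameter U \<and> diameter U \<le> r0 \<longrightarrow>
        (\<exists>g \<in> F \<inter> U \<rightarrow> F. \<forall>x\<in>F \<inter> U. \<forall>y\<in>F \<inter> U.
           a * inverse (diameter U) * dist x y \<le> dist (g x) (g y)))"

definition Q2 :: "'a::metric_space set \<Rightarrow> 'a set \<Rightarrow> real \<Rightarrow> real \<Rightarrow> bool" where
  "Q2 X F a r0 \<longleftrightarrow>
     (\<forall>c\<in>F. \<forall>r. 0 < r \<and> r \<le> r0 \<longrightarrow>
        (\<exists>g \<in> F \<rightarrow> F \<inter> (cball c r \<inter> X). \<forall>x\<in>F. \<forall>y\<in>F.
           a * r * dist x y \<le> dist (g x) (g y)))"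

end

theory Submission
  imports Defs
begin

text \<open>
  Write \<open>N r\<close> for the number of sets of diameter at most \<open>r\<close> that are needed to cover \<open>F\<close>.
  For every non-empty compact \<open>F\<close>, lower dimension \<open>\<le>\<close> lower box dimension, Hausdorff dimension
  \<open>\<le>\<close> lower box dimension \<open>\<le>\<close> upper box dimension \<open>\<le>\<close> Assouad dimension, and Hausdorff dimension
  \<open>\<le>\<close> packing dimension \<open>\<le>\<close> upper box dimension. The two hypotheses supply inequalities in the
  opposite direction.

  Under \<open>Q1\<close>, suppose that \<open>F\<close> has Hausdorff measure zero in dimension \<open>s\<close>. By compactness \<open>F\<close> has
  a finite cover by sets of diameter at most \<open>w\<^sub>i\<close> with \<open>(\<Sum>i. (w\<^sub>i / a) powr s) < 1\<close>, and then the sum is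
  still below \<open>1\<close> for some \<open>t < s\<close> in place of \<open>s\<close>. The \<open>i\<close>-th piece is expanded by the factor
  \<open>a / w\<^sub>i\<close> into \<open>F\<close>, so pulling back covers gives \<open>N r \<le> (\<Sum>i. N (a r / w\<^sub>i))\<close>, and induction over
  the scale yields \<open>N r \<le> C r powr (- t)\<close> (\<open>Q1_growth\<close>). A ball of radius \<open>R\<close> is expanded by
  \<open>a / (2 R)\<close> into \<open>F\<close>, whence the bound on \<open>N\<close> at scale \<open>r / R\<close> bounds the covering number of the
  ball, and the Assouad dimension is at most \<open>t\<close> (\<open>Q1_assouad_dim_less\<close>). Hence the Assouad dimension
  is at most the Hausdorff dimension, and the measure at a finite critical exponent is not zero.

  Under \<open>Q2\<close>, suppose that \<open>F\<close> contains \<open>m\<close> points at mutual distances above \<open>\<rho>\<close>. The balls of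
  radius \<open>\<rho> / 3\<close> around them contain copies of \<open>F\<close> expanded by \<open>\<kappa> = a \<rho> / 3\<close>, and a set of diameter
  below \<open>\<rho> / 3\<close> meets at most one copy. If \<open>m \<ge> 2\<close> and \<open>m \<kappa> powr t \<ge> 1\<close>, a cover of \<open>F\<close> of total
  \<open>t\<close>-content below \<open>(\<rho> / 3) powr t\<close> would split into one smaller cover per copy, one of which,
  expanded back, would again have too small a content; as covers are finite this is impossible
  (\<open>Q2_content_lower_bound\<close>). So if the Hausdorff measure in dimension \<open>t\<close> vanishes, then
  \<open>m \<le> \<kappa> powr (- t)\<close> for small \<open>\<rho>\<close>, and taking \<open>m\<close> maximal and \<open>\<rho> = r / 2\<close> one obtains
  \<open>N r \<le> (6 / a) powr t * r powr (- t)\<close> for small \<open>r\<close> (\<open>Q2_growth\<close>). Hence the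
  upper box dimension is at most the Hausdorff dimension. The constant stays bounded as \<open>t\<close>
  decreases to the Hausdorff dimension, so the measure there is finite. Moreover, a cover of a ball
  pulls back to a cover of \<open>F\<close> at the rescaled mesh, which bounds the lower dimension from below
  by the lower box dimension.

  If both conditions hold, \<open>Q1\<close> makes the dimension finite and the critical measure positive, \<open>Q2\<close>
  makes that measure finite, and the expanding maps transport it between balls and \<open>F\<close> with the
  factor \<open>r powr s\<close>; this is Ahlfors regularity.
\<close>

section \<open>Covers by sets of bounded diameter\<close>

text \<open>The bound is on distances instead of \<^const>\<open>diameter\<close>, because the latter is meaningful only
  on bounded sets; with a non-negative bound the two agree on bounded sets.\<close>

definition spread_le :: "real \<Rightarrow> 'a::metric_space set \<Rightarrow> bool" where
  "spread_le d U \<longleftrightarrow> (\<forall>x\<in>U. \<forall>y\<in>U. dist x y \<le> d)"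

text \<open>The maps in \<^const>\<open>Q1\<close> and \<^const>\<open>Q2\<close> are of this kind: they pull back sets of diameter \<open>r\<close> to
  sets of diameter at most \<open>r / c\<close>.\<close>

definition expands :: "real \<Rightarrow> ('a::metric_space \<Rightarrow> 'b::metric_space) \<Rightarrow> 'a set \<Rightarrow> bool" where
  "expands c f A \<longleftrightarrow> (\<forall>x\<in>A. \<forall>y\<in>A. c * dist x y \<le> dist (f x) (f y))"

text \<open>Covers by arbitrary sets, indexed by an upper bound for their size. Unlike relatively open
  covers they can be pulled back along expanding maps, which may be discontinuous; passing to open
  sets costs only a factor \<open>2\<close> in the mesh.\<close>

definition coverable :: "'a::metric_space set \<Rightarrow> real \<Rightarrow> nat \<Rightarrow> bool" where
  "coverable A r n \<longleftrightarrow>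
     (\<exists>\<U>. finite \<U> \<and> card \<U> \<le> n \<and> A \<subseteq> \<Union>\<U> \<and> (\<forall>U\<in>\<U>. spread_le r U))"

lemma spread_leD: "spread_le d U \<Longrightarrow> x \<in> U \<Longrightarrow> y \<in> U \<Longrightarrow> dist x y \<le> d"
  by (auto simp: spread_le_def)

lemma spread_le_mono: "spread_le d U \<Longrightarrow> V \<subseteq> U \<Longrightarrow> d \<le> d' \<Longrightarrow> spread_le d' V"
  unfolding spread_le_def by (meson order_trans subsetD)

lemma spread_le_imp_bounded: "spread_le d U \<Longrightarrow> bounded U"
  unfolding spread_le_def bounded_def by (cases "U = {}") blast+

lemma spread_le_diameter: "bounded U \<Longrightarrow> spread_le (diameter U) U"
  by (simp add: spread_le_def diameter_bounded_bound)

lemma diameter_le_spread: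
  assumes "spread_le d U" "0 \<le> d"
  shows "diameter U \<le> d"
proof (cases "U = {}")
  case False
  then show ?thesis
    using assms by (auto simp: diameter_def spread_le_def intro!: cSUP_least)
qed (use assms in simp)

lemma spread_le_cball: "spread_le (2 * r) (cball x r \<inter> A)"
  unfolding spread_le_def
proof (intro ballI)
  fix y z assume "y \<in> cball x r \<inter> A" "z \<in> cball x r \<inter> A"
  then show "dist y z \<le> 2 * r"
    using dist_triangle3[of y z x] by auto
qed

lemma spread_le_preimage:
  assumes "expands c f A" "0 < c" "spread_le r U"
  shows "spread_le (r / c) (A \<inter> f -` U)"
  unfolding spread_le_def
proof (intro ballI)
  fix x y assume xy: "x \<in> A \<inter> f -` U" "y \<in> A \<inter> f -` U"
  then have "c * dist x y \<le> dist (f x) (f y)"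
    using assms(1) by (auto simp: expands_def)
  also have "\<dots> \<le> r"
    using xy assms(3) by (auto simp: spread_le_def)
  finally show "dist x y \<le> r / c"
    using assms(2) by (simp add: field_simps)
qed

lemma coverable_mono:
  assumes "coverable A r n" "B \<subseteq> A" "r \<le> r'" "n \<le> n'"
  shows "coverable B r' n'"
proof -
  obtain \<U> where "finite \<U>" "card \<U> \<le> n" "A \<subseteq> \<Union>\<U>" "\<forall>U\<in>\<U>. spread_le r U"
    using assms(1) unfolding coverable_def by blast
  then show ?thesis
    using assms(2-4) unfolding coverable_def
    by (intro exI[of _ \<U>]) (auto intro: spread_le_mono)
qed

lemma coverable_preimage:
  assumes "expands c f A" "f \<in> A \<rightarrow> B" "0 < c" "coverable B r n"
  shows "coverable A (r / c) n"
proof -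
  obtain \<U> where U: "finite \<U>" "card \<U> \<le> n" "B \<subseteq> \<Union>\<U>" "\<forall>U\<in>\<U>. spread_le r U"
    using assms(4) unfolding coverable_def by blast
  let ?V = "(\<lambda>U. A \<inter> f -` U) ` \<U>"
  have "card ?V \<le> n"
    using card_image_le[OF U(1)] U(2) order_trans by blast
  moreover have "A \<subseteq> \<Union>?V"
    using assms(2) U(3) by fastforce
  ultimately show ?thesis
    unfolding coverable_def using U assms(1,3)
    by (intro exI[of _ ?V]) (auto intro: spread_le_preimage)
qed

lemma coverable_UN:
  assumes "finite I" "\<And>i. i \<in> I \<Longrightarrow> coverable (A i) r (n i)"
  shows "coverable (\<Union>i\<in>I. A i) r (\<Sum>i\<in>I. n i)"
proof -
  have "\<forall>i\<in>I. \<exists>\<U>. finite \<U> \<and> card \<U> \<le> n i \<and> A i \<subseteq> \<Union>\<U> \<and> (\<forall>U\<in>\<U>. spread_le r U)"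
    using assms(2) by (auto simp: coverable_def)
  then obtain W where W: "\<And>i. i \<in> I \<Longrightarrow> finite (W i) \<and> card (W i) \<le> n i \<and> A i \<subseteq> \<Union>(W i)
      \<and> (\<forall>U\<in>W i. spread_le r U)"
    by metis
  have "card (\<Union>i\<in>I. W i) \<le> (\<Sum>i\<in>I. card (W i))"
    by (rule card_UN_le[OF assms(1)])
  also have "\<dots> \<le> (\<Sum>i\<in>I. n i)"
    using W by (intro sum_mono) auto
  finally show ?thesis
    unfolding coverable_def using W assms(1)
    by (intro exI[of _ "\<Union>i\<in>I. W i"]) (auto, blast)
qed

lemma coverable_centres:
  assumes "finite S" "A \<subseteq> (\<Union>x\<in>S. cball x r)"
  shows "coverable A (2 * r) (card S)"
  unfolding coverable_def
  using assms card_image_le[OF assms(1), of "\<lambda>x. cball x r"] spread_le_cball[of r _ UNIV]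
  by (intro exI[of _ "(\<lambda>x. cball x r) ` S"]) auto

lemma compact_imp_coverable:
  assumes "compact A" "0 < r"
  shows "\<exists>n. coverable A r n"
proof -
  obtain k where "finite k" "A \<subseteq> (\<Union>x\<in>k. ball x (r / 2))"
    using assms compact_eq_totally_bounded by (metis half_gt_zero)
  then have "coverable A (2 * (r / 2)) (card k)"
    by (intro coverable_centres) (force simp: less_imp_le)+
  then show ?thesis
    by auto
qed

lemma coverable_pos: "coverable A r n \<Longrightarrow> A \<noteq> {} \<Longrightarrow> 0 < n"
  unfolding coverable_def by (metis Sup_empty card_0_eq gr_zeroI le_zero_eq subset_empty)

section \<open>Covering numbers\<close>

text \<open>Fattening each set of the cover by \<open>r / 4\<close> makes it open and at most doubles the bound on its
  diameter, since \<open>r + 2 r / 4 \<le> 2 r\<close>.\<close>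

lemma coverable_imp_open_cover:
  assumes "A \<subseteq> X" "0 < r" "coverable A r n"
  shows "\<exists>\<V>. finite \<V> \<and> card \<V> \<le> n \<and> A \<subseteq> \<Union>\<V> \<and>
        (\<forall>U\<in>\<V>. openin (top_of_set X) U \<and> diameter U \<le> 2 * r)"
proof -
  obtain \<U> where U: "finite \<U>" "card \<U> \<le> n" "A \<subseteq> \<Union>\<U>" "\<forall>U\<in>\<U>. spread_le r U"
    using assms(3) unfolding coverable_def by blast
  define G where "G U = X \<inter> (\<Union>y\<in>U. ball y (r / 4))" for U
  have "openin (top_of_set X) (G U)" for U
    unfolding G_def by (simp add: openin_open_Int open_UN)
  moreover have "diameter (G U) \<le> 2 * r" if "U \<in> \<U>" for U
  proof (rule diameter_le_spread)
    have "dist x y \<le> 2 * r" if xy: "x \<in> G U" "y \<in> G U" for x y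
    proof -
      obtain u v where uv: "u \<in> U" "v \<in> U" "dist u x < r / 4" "dist v y < r / 4"
        using xy unfolding G_def by auto
      have "dist u v \<le> r"
        using U(4) \<open>U \<in> \<U>\<close> uv by (auto simp: spread_le_def)
      moreover have "dist x y \<le> dist u x + dist u v + dist v y"
        using dist_triangle[of x y u] dist_triangle[of u y v] by (simp add: dist_commute)
      ultimately show ?thesis
        using uv assms(2) by linarith
    qed
    then show "spread_le (2 * r) (G U)"
      by (simp add: spread_le_def)
  qed (use assms(2) in simp)
  moreover have "A \<subseteq> \<Union>(G ` \<U>)"
  proof
    fix x assume "x \<in> A"
    then obtain U' where "U' \<in> \<U>" "x \<in> U'" "x \<in> X"
      using U(3) assms(1) by auto
    then show "x \<in> \<Union>(G ` \<U>)"
      unfolding G_def using assms(2) by force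
  qed
  moreover have "card (G ` \<U>) \<le> n"
    using card_image_le[OF U(1)] U(2) order_trans by blast
  ultimately show ?thesis
    using U(1) by (intro exI[of _ "G ` \<U>"]) auto
qed

lemma covering_number_witness:
  assumes "compact X" "A \<subseteq> X" "0 < r"
  obtains \<V> where "finite \<V>" "card \<V> = covering_number X r A" "A \<subseteq> \<Union>\<V>"
    "\<And>U. U \<in> \<V> \<Longrightarrow> openin (top_of_set X) U \<and> diameter U \<le> r"
proof -
  obtain n where "coverable X (r / 2) n"
    using compact_imp_coverable[OF assms(1)] assms(3) by (metis half_gt_zero)
  then have "coverable A (r / 2) n"
    using assms(2) by (auto intro: coverable_mono)
  from coverable_imp_open_cover[OF assms(2) _ this]
  have "\<exists>n \<U>. finite \<U> \<and> card \<U> = n \<and> A \<subseteq> \<Union>\<U> \<and>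
        (\<forall>U\<in>\<U>. openin (top_of_set X) U \<and> diameter U \<le> r)"
    using assms(3) by auto
  from LeastI_ex[OF this] show ?thesis
    unfolding covering_number_def[symmetric] using that by blast
qed

lemma covering_number_le_card:
  assumes "finite \<V>" "A \<subseteq> \<Union>\<V>" "\<And>U. U \<in> \<V> \<Longrightarrow> openin (top_of_set X) U \<and> diameter U \<le> r"
  shows "covering_number X r A \<le> card \<V>"
  unfolding covering_number_def by (rule Least_le) (use assms in blast)

lemma coverable_covering_number:
  assumes "compact X" "A \<subseteq> X" "0 < r"
  shows "coverable A r (covering_number X r A)"
proof -
  obtain \<V> where V: "finite \<V>" "card \<V> = covering_number X r A" "A \<subseteq> \<Union>\<V>"
    "\<And>U. U \<in> \<V> \<Longrightarrow> openin (top_of_set X) U \<and> diameter U \<le> r"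
    using covering_number_witness[OF assms] by metis
  have "spread_le r U" if "U \<in> \<V>" for U
  proof -
    have "bounded U"
      using V(4)[OF that] assms(1) openin_imp_subset compact_imp_bounded bounded_subset by metis
    from spread_le_diameter[OF this] show ?thesis
      using V(4)[OF that] by (auto intro: spread_le_mono)
  qed
  then show ?thesis
    unfolding coverable_def using V by (intro exI[of _ \<V>]) auto
qed

lemma covering_number_le:
  assumes "A \<subseteq> X" "0 < r" "coverable A r n"
  shows "covering_number X (2 * r) A \<le> n"
proof -
  obtain \<V> where "finite \<V>" "card \<V> \<le> n" "A \<subseteq> \<Union>\<V>"
    "\<forall>U\<in>\<V>. openin (top_of_set X) U \<and> diameter U \<le> 2 * r"
    using coverable_imp_open_cover[OF assms] by blast
  then show ?thesis
    using covering_number_le_card[of \<V> A X "2 * r"] by auto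
qed

lemma covering_number_mono:
  assumes "compact X" "B \<subseteq> X" "0 < r" "A \<subseteq> B"
  shows "covering_number X r A \<le> covering_number X r B"
proof -
  obtain \<V> where V: "finite \<V>" "card \<V> = covering_number X r B" "B \<subseteq> \<Union>\<V>"
    "\<And>U. U \<in> \<V> \<Longrightarrow> openin (top_of_set X) U \<and> diameter U \<le> r"
    using covering_number_witness[OF assms(1-3)] by metis
  then show ?thesis
    using covering_number_le_card[of \<V> A X r] assms(4) by auto
qed

lemma covering_number_ge_1:
  assumes "compact X" "A \<subseteq> X" "0 < r" "A \<noteq> {}"
  shows "1 \<le> covering_number X r A"
  using coverable_pos[OF coverable_covering_number[OF assms(1-3)] assms(4)] by simp

section \<open>Hausdorff measure\<close>

lemma diam_pow_le:
  assumes "spread_le w U" "0 < w" "0 \<le> s"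
  shows "diam_pow s U \<le> ennreal (w powr s)"
proof -
  have "diameter U \<le> w"
    using diameter_le_spread[OF assms(1)] assms(2) by simp
  moreover have "0 \<le> diameter U"
    using diameter_ge_0[OF spread_le_imp_bounded[OF assms(1)]] .
  ultimately show ?thesis
    using assms by (auto simp: diam_pow_def intro!: ennreal_leI powr_mono2)
qed

lemma hausdorff_premeasure_antimono:
  assumes "d \<le> d'"
  shows "hausdorff_premeasure s d' A \<le> hausdorff_premeasure s d A"
  unfolding hausdorff_premeasure_def
proof (rule INF_superset_mono[OF _ order_refl], rule Collect_mono, rule impI)
  fix U :: "nat \<Rightarrow> 'a set"
  assume "A \<subseteq> (\<Union>i. U i) \<and> (\<forall>i. bounded (U i) \<and> diameter (U i) \<le> d)"
  then show "A \<subseteq> (\<Union>i. U i) \<and> (\<forall>i. bounded (U i) \<and> diameter (U i) \<le> d')"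
    using assms by (meson order_trans)
qed

lemma hausdorff_premeasure_le_measure:
  "0 < d \<Longrightarrow> hausdorff_premeasure s d A \<le> hausdorff_measure s A"
  unfolding hausdorff_measure_def by (intro SUP_upper) auto

lemma hausdorff_measure_mono:
  assumes "A \<subseteq> B"
  shows "hausdorff_measure s A \<le> hausdorff_measure s B"
  unfolding hausdorff_measure_def
proof (rule SUP_subset_mono[OF order_refl])
  show "hausdorff_premeasure s d A \<le> hausdorff_premeasure s d B" for d
    unfolding hausdorff_premeasure_def
    by (rule INF_superset_mono[OF _ order_refl], rule Collect_mono) (use assms in blast)
qed

lemma hausdorff_premeasure_le_suminf:
  assumes "A \<subseteq> (\<Union>i. U i)" "\<And>i. bounded (U i) \<and> diameter (U i) \<le> d"
  shows "hausdorff_premeasure s d A \<le> (\<Sum>i. diam_pow s (U (i::nat)))"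
  unfolding hausdorff_premeasure_def using assms by (intro INF_lower) auto

lemma hausdorff_premeasure_le_coverable:
  assumes "coverable A d n" "0 < d" "0 \<le> s"
  shows "hausdorff_premeasure s d A \<le> ennreal (real n * d powr s)"
proof -
  obtain \<U> where U: "finite \<U>" "card \<U> \<le> n" "A \<subseteq> \<Union>\<U>" "\<forall>U\<in>\<U>. spread_le d U"
    using assms(1) unfolding coverable_def by blast
  obtain xs where xs: "set xs = \<U>" "distinct xs"
    using finite_distinct_list[OF U(1)] by blast
  define V where "V i = (if i < length xs then xs ! i else {})" for i
  have sp: "spread_le d (V i)" for i
    using U(4) xs(1) unfolding V_def by (auto simp: spread_le_def[of _ "{}"])
  have "hausdorff_premeasure s d A \<le> (\<Sum>i. diam_pow s (V i))"
  proof (rule hausdorff_premeasure_le_suminf)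
    show "A \<subseteq> (\<Union>i. V i)"
    proof
      fix x assume "x \<in> A"
      then obtain i where "i < length xs" "x \<in> xs ! i"
        using U(3) xs(1) by (metis UnionE in_set_conv_nth subsetD)
      then show "x \<in> (\<Union>i. V i)"
        unfolding V_def by (intro UN_I[of i]) auto
    qed
    show "bounded (V i) \<and> diameter (V i) \<le> d" for i
      using sp[of i] spread_le_imp_bounded diameter_le_spread assms(2) by force
  qed
  also have "\<dots> = (\<Sum>i<length xs. diam_pow s (V i))"
    by (intro suminf_finite) (auto simp: V_def diam_pow_def)
  also have "\<dots> \<le> (\<Sum>i<length xs. ennreal (d powr s))"
    by (intro sum_mono diam_pow_le sp assms)
  also have "\<dots> = ennreal (real (length xs) * d powr s)"
    by (simp add: ennreal_mult ennreal_of_nat_eq_real_of_nat)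
  also have "\<dots> \<le> ennreal (real n * d powr s)"
    using U(2) xs distinct_card[OF xs(2)] by (intro ennreal_leI mult_right_mono) auto
  finally show ?thesis .
qed

text \<open>The diameter may be replaced by a strictly larger number at an arbitrarily small cost in
  content. For \<open>s > 0\<close> the number \<open>w\<close> is chosen such that \<open>w powr s = diameter U powr s + e\<close>; for
  \<open>s = 0\<close> every non-empty set costs \<open>1\<close> whatever its size.\<close>

lemma enlarged_diameter:
  assumes "bounded U" "U \<noteq> {}" "0 \<le> s" "0 < e"
  shows "\<exists>w. diameter U < w \<and> ennreal (w powr s) \<le> diam_pow s U + ennreal e"
proof (cases "s = 0")
  case True
  have "diameter U + 1 > 0"
    using diameter_ge_0[OF assms(1)] by simp
  then show ?thesis
    using True assms by (intro exI[of _ "diameter U + 1"]) (auto simp: diam_pow_def)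
next
  case False
  let ?d = "diameter U"
  let ?w = "(?d powr s + e) powr (1 / s)"
  have d: "0 \<le> ?d"
    by (rule diameter_ge_0[OF assms(1)])
  have "?d = (?d powr s) powr (1 / s)"
    using False d by (simp add: powr_powr)
  also have "\<dots> < ?w"
    using assms False by (intro powr_less_mono2) auto
  finally have "?d < ?w" .
  moreover have "?w powr s = ?d powr s + e"
    using False assms by (simp add: powr_powr add_nonneg_nonneg)
  ultimately show ?thesis
    using False assms by (intro exI[of _ ?w]) (auto simp: diam_pow_def)
qed

text \<open>The sets of a countable cover are fattened to open sets at a geometrically decreasing cost, after
  which compactness leaves finitely many. The numbers \<open>w i\<close> are positive even for sets of diameter
  zero, so that a single point can be rescaled by a factor \<open>a / w i\<close> like any other piece.\<close>

lemma finite_cover_of_premeasure: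
  assumes "compact F" "hausdorff_premeasure s d F < ennreal c" "0 \<le> s"
  obtains I :: "nat set" and V w where "finite I" "F \<subseteq> (\<Union>i\<in>I. V i)"
    "\<And>i. i \<in> I \<Longrightarrow> 0 < w i \<and> spread_le (w i) (V i)" "(\<Sum>i\<in>I. w i powr s) < c"
proof -
  obtain U where U: "F \<subseteq> (\<Union>i. U i)" "\<And>i::nat. bounded (U i)"
    and lt: "(\<Sum>i. diam_pow s (U i)) < ennreal c"
    using assms(2) unfolding hausdorff_premeasure_def INF_less_iff by auto
  obtain \<tau> where \<tau>: "(\<Sum>i. diam_pow s (U i)) = ennreal \<tau>" "0 \<le> \<tau>"
    using lt by (cases "\<Sum>i. diam_pow s (U i)" rule: ennreal_cases) auto
  have "\<tau> < c"
    using lt \<tau> by (simp add: ennreal_less_iff)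
  define e where "e i = (c - \<tau>) / 2 * (1/2) ^ Suc i" for i :: nat
  have e_pos: "0 < e i" for i
    using \<open>\<tau> < c\<close> by (simp add: e_def)
  have e_sums: "e sums ((c - \<tau>) / 2)"
    using sums_mult[OF power_half_series, of "(c - \<tau>) / 2"] unfolding e_def by simp
  have "\<exists>w. U i \<noteq> {} \<longrightarrow> diameter (U i) < w \<and> ennreal (w powr s) \<le> diam_pow s (U i) + ennreal (e i)" for i
    using enlarged_diameter[OF U(2) _ assms(3) e_pos, of i i] by blast
  then obtain w where w: "\<And>i. U i \<noteq> {} \<Longrightarrow> diameter (U i) < w i"
    "\<And>i. U i \<noteq> {} \<Longrightarrow> ennreal (w i powr s) \<le> diam_pow s (U i) + ennreal (e i)"
    by metis
  define V where "V i = (\<Union>y\<in>U i. ball y ((w i - diameter (U i)) / 2))" for i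
  have "F \<subseteq> (\<Union>i\<in>{i. U i \<noteq> {}}. V i)"
  proof
    fix x assume "x \<in> F"
    then obtain i where "x \<in> U i"
      using U(1) by auto
    moreover from this have "diameter (U i) < w i"
      using w(1)[of i] by blast
    ultimately have "x \<in> V i" "U i \<noteq> {}"
      unfolding V_def by (auto intro!: bexI[of _ x])
    then show "x \<in> (\<Union>i\<in>{i. U i \<noteq> {}}. V i)"
      by blast
  qed
  moreover have "open (V i)" for i
    by (simp add: V_def open_UN)
  ultimately obtain I where I: "I \<subseteq> {i. U i \<noteq> {}}" "finite I" "F \<subseteq> (\<Union>i\<in>I. V i)"
    using compactE_image[OF assms(1), of "{i. U i \<noteq> {}}" V] by metis
  have pos: "0 < w i \<and> spread_le (w i) (V i)" if "i \<in> I" for i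
  proof
    have lt: "diameter (U i) < w i"
      using I(1) that by (intro w(1)) blast
    show "0 < w i"
      using diameter_ge_0[OF U(2)[of i]] lt by linarith
    show "spread_le (w i) (V i)"
      unfolding spread_le_def
    proof (intro ballI)
      fix x y assume xy: "x \<in> V i" "y \<in> V i"
      obtain u v where uv: "u \<in> U i" "v \<in> U i" "dist u x < (w i - diameter (U i)) / 2"
        "dist v y < (w i - diameter (U i)) / 2"
        using xy unfolding V_def by auto
      have "dist u v \<le> diameter (U i)"
        using diameter_bounded_bound[OF U(2)] uv by auto
      then show "dist x y \<le> w i"
        using uv dist_triangle[of x y u] dist_triangle[of u y v] by (simp add: dist_commute)
    qed
  qed
  have "ennreal (\<Sum>i\<in>I. w i powr s) = (\<Sum>i\<in>I. ennreal (w i powr s))"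
    by (simp add: sum_ennreal)
  also have "\<dots> \<le> (\<Sum>i\<in>I. diam_pow s (U i) + ennreal (e i))"
    using I(1) w(2) by (intro sum_mono) auto
  also have "\<dots> \<le> (\<Sum>i. diam_pow s (U i) + ennreal (e i))"
    by (intro sum_le_suminf I(2)) auto
  also have "\<dots> = ennreal \<tau> + (\<Sum>i. ennreal (e i))"
    by (simp add: suminf_add[symmetric] \<tau>(1))
  also have "(\<Sum>i. ennreal (e i)) = ennreal ((c - \<tau>) / 2)"
    using e_sums e_pos \<open>\<tau> < c\<close> by (intro sums_unique[symmetric]) (simp add: less_imp_le)
  also have "ennreal \<tau> + ennreal ((c - \<tau>) / 2) < ennreal c"
    using \<tau>(2) \<open>\<tau> < c\<close> by (simp flip: ennreal_plus add: ennreal_less_iff field_simps)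
  finally have "(\<Sum>i\<in>I. w i powr s) < c"
    by (simp add: ennreal_less_iff sum_nonneg)
  then show ?thesis
    using that I pos by blast
qed

text \<open>Near-optimal covers of the \<open>E i\<close>, with errors \<open>e / 2 ^ Suc i\<close>, are merged into one sequence by
  the pairing function on the natural numbers.\<close>

lemma hausdorff_premeasure_subadditive:
  assumes "A \<subseteq> (\<Union>i::nat. E i)"
  shows "hausdorff_premeasure s d A \<le> (\<Sum>i. hausdorff_premeasure s d (E i))"
proof (rule ennreal_le_epsilon)
  fix e :: real
  assume fin: "(\<Sum>i. hausdorff_premeasure s d (E i)) < top" and e: "0 < e"
  have "\<exists>U. E i \<subseteq> (\<Union>j::nat. U j) \<and> (\<forall>j. bounded (U j) \<and> diameter (U j) \<le> d) \<and>
      (\<Sum>j. diam_pow s (U j)) \<le> hausdorff_premeasure s d (E i) + ennreal (e * (1/2) ^ Suc i)" for i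
  proof -
    have "hausdorff_premeasure s d (E i) \<noteq> top"
      using ennreal_suminf_lessD[OF fin, of i] by auto
    then have "hausdorff_premeasure s d (E i) < hausdorff_premeasure s d (E i) + ennreal (e * (1/2) ^ Suc i)"
      using e by (cases "hausdorff_premeasure s d (E i)" rule: ennreal_cases)
        (auto simp flip: ennreal_plus simp: ennreal_less_iff)
    then show ?thesis
      unfolding hausdorff_premeasure_def[of s d "E i"]
      by (subst (asm) INF_less_iff) (auto intro: less_imp_le)
  qed
  then obtain U where U: "\<And>i. E i \<subseteq> (\<Union>j::nat. U i j)"
    "\<And>i j. bounded (U i j) \<and> diameter (U i j) \<le> d"
    "\<And>i. (\<Sum>j. diam_pow s (U i j)) \<le> hausdorff_premeasure s d (E i) + ennreal (e * (1/2) ^ Suc i)"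
    by metis
  define V where "V n = (case prod_decode n of (i, j) \<Rightarrow> U i j)" for n
  have "hausdorff_premeasure s d A \<le> (\<Sum>n. diam_pow s (V n))"
  proof (rule hausdorff_premeasure_le_suminf)
    show "A \<subseteq> (\<Union>n. V n)"
    proof
      fix x assume "x \<in> A"
      then obtain i j where "x \<in> U i j"
        using assms U(1) by blast
      then show "x \<in> (\<Union>n. V n)"
        by (auto simp: V_def intro!: exI[of _ "prod_encode (i, j)"])
    qed
    show "bounded (V n) \<and> diameter (V n) \<le> d" for n
      using U(2) by (simp add: V_def split: prod.split)
  qed
  also have "\<dots> = (\<Sum>i. \<Sum>j. diam_pow s (U i j))"
    using suminf_ennreal_2dimen[of "\<lambda>i. \<Sum>j. diam_pow s (U i j)" "\<lambda>p. diam_pow s (U (fst p) (snd p))"]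
    by (simp add: V_def o_def case_prod_beta)
  also have "\<dots> \<le> (\<Sum>i. hausdorff_premeasure s d (E i) + ennreal (e * (1/2) ^ Suc i))"
    using U(3) by (intro suminf_le) auto
  also have "\<dots> = (\<Sum>i. hausdorff_premeasure s d (E i)) + (\<Sum>i. ennreal (e * (1/2) ^ Suc i))"
    by (intro suminf_add[symmetric]) auto
  also have "(\<Sum>i. ennreal (e * (1/2) ^ Suc i)) = ennreal e"
    using sums_mult[OF power_half_series, of e] e by (intro sums_unique[symmetric]) auto
  finally show "hausdorff_premeasure s d A \<le> (\<Sum>i. hausdorff_premeasure s d (E i)) + ennreal e" .
qed

lemma diam_pow_preimage:
  assumes "expands c f A" "0 < c" "0 \<le> s" "bounded U"
  shows "ennreal (c powr s) * diam_pow s (A \<inter> f -` U) \<le> diam_pow s U"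
proof (cases "A \<inter> f -` U = {}")
  case False
  have sp: "spread_le (diameter U / c) (A \<inter> f -` U)"
    by (intro spread_le_preimage assms spread_le_diameter)
  have "0 \<le> diameter U" "0 \<le> diameter (A \<inter> f -` U)"
    using sp assms(4) diameter_ge_0 spread_le_imp_bounded by auto
  moreover have "diameter (A \<inter> f -` U) \<le> diameter U / c"
    using diameter_le_spread[OF sp] calculation assms(2) by simp
  ultimately have "diameter (A \<inter> f -` U) powr s \<le> (diameter U / c) powr s"
    using assms(3) by (intro powr_mono2) auto
  then have "c powr s * diameter (A \<inter> f -` U) powr s \<le> diameter U powr s"
    using assms(2) \<open>0 \<le> diameter U\<close> by (simp add: powr_divide field_simps)
  then have "ennreal (c powr s) * ennreal (diameter (A \<inter> f -` U) powr s) \<le> ennreal (diameter U powr s)"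
    by (simp flip: ennreal_mult add: ennreal_leI)
  moreover have "U \<noteq> {}"
    using False by auto
  ultimately show ?thesis
    using False assms(2) by (simp add: diam_pow_def)
qed (simp add: diam_pow_def)

text \<open>Covers of the target pull back along \<open>f\<close> to covers of \<open>A\<close>, and pulling back divides the bounds on the
  diameters by \<open>c\<close>.\<close>

lemma hausdorff_measure_expands:
  assumes "expands c f A" "f \<in> A \<rightarrow> B" "0 < c" "0 \<le> s"
  shows "ennreal (c powr s) * hausdorff_measure s A \<le> hausdorff_measure s B"
  unfolding hausdorff_measure_def[of s A]
proof (subst SUP_mult_left_ennreal, rule SUP_least)
  fix d :: real assume "d \<in> {0<..}"
  then have d: "0 < d" by simp
  have "ennreal (c powr s) * hausdorff_premeasure s d A \<le> hausdorff_premeasure s (c * d) B"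
    unfolding hausdorff_premeasure_def[of s "c * d"]
  proof (rule INF_greatest)
    fix U :: "nat \<Rightarrow> 'b set"
    assume "U \<in> {U. B \<subseteq> (\<Union>i. U i) \<and> (\<forall>i. bounded (U i) \<and> diameter (U i) \<le> c * d)}"
    then have U: "B \<subseteq> (\<Union>i. U i)" "\<And>i. bounded (U i)" "\<And>i. diameter (U i) \<le> c * d"
      by auto
    have "hausdorff_premeasure s d A \<le> (\<Sum>i. diam_pow s (A \<inter> f -` U i))"
    proof (rule hausdorff_premeasure_le_suminf)
      show "A \<subseteq> (\<Union>i. A \<inter> f -` U i)"
        using assms(2) U(1) by fastforce
      fix i
      have "spread_le d (A \<inter> f -` U i)"
        using spread_le_preimage[OF assms(1,3), of "c * d" "U i"] assms(3)
          spread_le_mono[OF spread_le_diameter[OF U(2)] order_refl U(3)] by simp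
      then show "bounded (A \<inter> f -` U i) \<and> diameter (A \<inter> f -` U i) \<le> d"
        using spread_le_imp_bounded diameter_le_spread d by force
    qed
    then have "ennreal (c powr s) * hausdorff_premeasure s d A
        \<le> ennreal (c powr s) * (\<Sum>i. diam_pow s (A \<inter> f -` U i))"
      by (rule mult_left_mono) simp
    also have "\<dots> = (\<Sum>i. ennreal (c powr s) * diam_pow s (A \<inter> f -` U i))"
      by simp
    also have "\<dots> \<le> (\<Sum>i. diam_pow s (U i))"
      using diam_pow_preimage[OF assms(1,3,4) U(2)] by (intro suminf_le) auto
    finally show "ennreal (c powr s) * hausdorff_premeasure s d A \<le> (\<Sum>i. diam_pow s (U i))" .
  qed
  also have "\<dots> \<le> hausdorff_measure s B"
    using assms(3) d by (intro hausdorff_premeasure_le_measure) simp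
  finally show "ennreal (c powr s) * hausdorff_premeasure s d A \<le> hausdorff_measure s B" .
qed

section \<open>Box, Assouad and lower dimension\<close>

text \<open>Growth of order at most \<open>t\<close> of the covering numbers, at the scales below \<open>d\<close>. The upper box dimension
  is the infimum of the exponents that occur; the constant and the range of scales are explicit because the finiteness of the
  critical measure depends on their being uniform in \<open>t\<close>.\<close>

definition covering_growth :: "'a::metric_space set \<Rightarrow> real \<Rightarrow> real \<Rightarrow> real \<Rightarrow> bool" where
  "covering_growth F C t d \<longleftrightarrow>
     (\<forall>r. 0 < r \<and> r < d \<longrightarrow> (\<exists>n. coverable F r n \<and> real n \<le> C * r powr (- t)))"

lemma ereal_le_by_real_above:
  assumes "\<And>t. y < ereal t \<Longrightarrow> x \<le> ereal t"
  shows "x \<le> y"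
  using assms ereal_dense2 by (metis leD leI)

lemma ereal_le_by_real_below:
  assumes "\<And>t. ereal t < x \<Longrightarrow> ereal t \<le> y"
  shows "x \<le> y"
  using assms ereal_dense2 by (metis leD leI)

lemma tendsto_plus_const_over_log:
  "((\<lambda>r. ereal (t + K / (- ln r))) \<longlongrightarrow> ereal t) (at_right 0)"
proof -
  have "LIM r at_right (0::real). - ln r :> at_infinity"
    using ln_at_0 filterlim_uminus_at_bot filterlim_at_top_imp_at_infinity by blast
  from tendsto_add[OF tendsto_const tendsto_divide_0[OF tendsto_const this]]
  have "((\<lambda>r. t + K / (- ln r)) \<longlongrightarrow> t + 0) (at_right 0)" .
  then show ?thesis
    by simp
qed

lemma eventually_at_right_0:
  "0 < d \<Longrightarrow> (\<And>r. 0 < r \<Longrightarrow> r < d \<Longrightarrow> P r) \<Longrightarrow> eventually P (at_right (0::real))"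
  unfolding eventually_at_right_field by blast

lemma upper_box_dim_le:
  assumes "0 < d" "0 < C" "\<And>r. 0 < r \<Longrightarrow> r < d \<Longrightarrow> 1 \<le> covering_number X r F"
    "\<And>r. 0 < r \<Longrightarrow> r < d \<Longrightarrow> real (covering_number X r F) \<le> C * r powr (- t)"
  shows "upper_box_dim X F \<le> ereal t"
proof -
  have "ereal (ln (real (covering_number X r F)) / (- ln r)) \<le> ereal (t + ln C / (- ln r))"
    if r: "0 < r" "r < min d 1" for r
  proof -
    have "ln (real (covering_number X r F)) \<le> ln (C * r powr (- t))"
      using assms(3)[of r] assms(4)[of r] r by (subst ln_le_cancel_iff) (auto intro: mult_pos_pos assms(2))
    also have "\<dots> = ln C + t * (- ln r)"
      using r assms(2) by (simp add: ln_mult ln_powr)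
    finally have "ln (real (covering_number X r F)) / (- ln r) \<le> (ln C + t * (- ln r)) / (- ln r)"
      using r by (intro divide_right_mono) auto
    also have "\<dots> = t + ln C / (- ln r)"
      using r ln_less_zero[of r] by (simp add: field_simps)
    finally show ?thesis
      by simp
  qed
  then have "upper_box_dim X F \<le> Limsup (at_right 0) (\<lambda>r. ereal (t + ln C / (- ln r)))"
    unfolding upper_box_dim_def
    by (intro Limsup_mono eventually_at_right_0[of "min d 1"]) (use assms(1) in auto)
  also have "\<dots> = ereal t"
    by (intro lim_imp_Limsup tendsto_plus_const_over_log) simp
  finally show ?thesis .
qed

lemma lower_box_dim_ge:
  assumes "0 < d" "0 < C"
    "\<And>r. 0 < r \<Longrightarrow> r < d \<Longrightarrow> C * r powr (- t) \<le> real (covering_number X r F)"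
  shows "ereal t \<le> lower_box_dim X F"
proof -
  have "ereal (t + ln C / (- ln r)) \<le> ereal (ln (real (covering_number X r F)) / (- ln r))"
    if r: "0 < r" "r < min d 1" for r
  proof -
    have "t + ln C / (- ln r) = (ln C + t * (- ln r)) / (- ln r)"
      using r ln_less_zero[of r] by (simp add: field_simps)
    also have "ln C + t * (- ln r) = ln (C * r powr (- t))"
      using r assms(2) by (simp add: ln_mult ln_powr)
    also have "\<dots> / (- ln r) \<le> ln (real (covering_number X r F)) / (- ln r)"
    proof (rule divide_right_mono)
      have "0 < C * r powr (- t)"
        using assms(2) r by simp
      then show "ln (C * r powr (- t)) \<le> ln (real (covering_number X r F))"
        using assms(3)[of r] r by (intro ln_mono) auto
    qed (use r in simp)
    finally show ?thesis
      by simp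
  qed
  then have "Liminf (at_right 0) (\<lambda>r. ereal (t + ln C / (- ln r))) \<le> lower_box_dim X F"
    unfolding lower_box_dim_def
    by (intro Liminf_mono eventually_at_right_0[of "min d 1"]) (use assms(1) in auto)
  moreover have "Liminf (at_right 0) (\<lambda>r. ereal (t + ln C / (- ln r))) = ereal t"
    by (intro lim_imp_Liminf tendsto_plus_const_over_log) simp
  ultimately show ?thesis
    by simp
qed

lemma lower_box_dim_le_upper: "lower_box_dim X F \<le> upper_box_dim X F"
  unfolding lower_box_dim_def upper_box_dim_def by (intro Liminf_le_Limsup) simp

text \<open>The quotient in the definition of the box dimensions, read as a power law.\<close>

lemma log_ratio_less_iff:
  assumes "0 < r" "r < 1" "1 \<le> n"
  shows "ln (real n) / (- ln r) < t \<longleftrightarrow> real n < r powr (- t)"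
proof -
  have "ln (real n) / (- ln r) < t \<longleftrightarrow> ln (real n) < ln (r powr (- t))"
    using assms ln_less_zero[of r] by (subst pos_divide_less_eq) (auto simp: ln_powr)
  also have "\<dots> \<longleftrightarrow> real n < r powr (- t)"
    using assms by (subst ln_less_cancel_iff) auto
  finally show ?thesis .
qed

context
  fixes X F :: "'a::metric_space set"
  assumes X: "compact X" and FX: "F \<subseteq> X" and F: "compact F" and F_ne: "F \<noteq> {}"
begin

lemma upper_box_dim_le_growth:
  assumes "covering_growth F C t d" "0 < d"
  shows "upper_box_dim X F \<le> ereal t"
proof (rule upper_box_dim_le)
  have bound: "1 \<le> covering_number X r F \<and>
      real (covering_number X r F) \<le> C * 2 powr t * r powr (- t)" if "0 < r" "r < d" for r
  proof -
    have "0 < r / 2 \<and> r / 2 < d"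
      using that by simp
    then obtain n where n: "coverable F (r / 2) n" "real n \<le> C * (r / 2) powr (- t)"
      using assms(1) unfolding covering_growth_def by blast
    have "covering_number X r F \<le> n"
      using covering_number_le[OF FX _ n(1)] that by simp
    moreover have "(r / 2) powr (- t) = 2 powr t * r powr (- t)"
      using that by (simp add: powr_divide powr_minus field_simps)
    ultimately show ?thesis
      using n(2) covering_number_ge_1[OF X FX that(1) F_ne] by (auto simp: mult_ac)
  qed
  then show "\<And>r. 0 < r \<Longrightarrow> r < d \<Longrightarrow> 1 \<le> covering_number X r F"
    "\<And>r. 0 < r \<Longrightarrow> r < d \<Longrightarrow> real (covering_number X r F) \<le> C * 2 powr t * r powr (- t)"
    by auto
  from bound[of "d / 2"] show "0 < C * 2 powr t"
    using assms(2) by (smt (verit) field_sum_of_halves of_nat_1 of_nat_mono powr_gt_zero zero_less_mult_pos2)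
qed (fact assms(2))

lemma growth_if_upper_box_dim_less:
  assumes "upper_box_dim X F < ereal t"
  shows "\<exists>d>0. covering_growth F 1 t d"
proof -
  have "eventually (\<lambda>r. ereal (ln (real (covering_number X r F)) / (- ln r)) < ereal t) (at_right 0)"
    using assms unfolding upper_box_dim_def by (rule Limsup_lessD)
  then obtain d where d: "0 < d"
    "\<And>r. 0 < r \<Longrightarrow> r < d \<Longrightarrow> ln (real (covering_number X r F)) / (- ln r) < t"
    unfolding eventually_at_right_field by auto
  have "covering_growth F 1 t (min d 1)"
    unfolding covering_growth_def
  proof (intro allI impI, elim conjE)
    fix r :: real assume r: "0 < r" "r < min d 1"
    then have "real (covering_number X r F) < r powr (- t)"
      using d(2)[of r] log_ratio_less_iff[OF r(1)] covering_number_ge_1[OF X FX r(1) F_ne] by simp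
    then show "\<exists>n. coverable F r n \<and> real n \<le> 1 * r powr (- t)"
      using coverable_covering_number[OF X FX r(1)] by (intro exI[of _ "covering_number X r F"]) simp
  qed
  then show ?thesis
    using d(1) by (intro exI[of _ "min d 1"]) simp
qed

lemma coverable_if_lower_box_dim_less:
  assumes "lower_box_dim X F < ereal t" "0 < d"
  shows "\<exists>r n. 0 < r \<and> r < d \<and> coverable F r n \<and> real n \<le> r powr (- t)"
proof (rule ccontr)
  assume none: "\<not> ?thesis"
  have "ereal t \<le> ereal (ln (real (covering_number X r F)) / (- ln r))"
    if r: "0 < r" "r < min d 1" for r
  proof -
    have "\<not> real (covering_number X r F) < r powr (- t)"
      using none coverable_covering_number[OF X FX r(1)] r by (metis less_imp_le min_less_iff_conj)
    then show ?thesis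
      using log_ratio_less_iff[OF r(1), of "covering_number X r F" t]
        covering_number_ge_1[OF X FX r(1) F_ne] r by (simp add: not_less)
  qed
  then have "ereal t \<le> lower_box_dim X F"
    unfolding lower_box_dim_def
    by (intro Liminf_bounded eventually_at_right_0[of "min d 1"]) (use assms(2) in auto)
  then show False
    using assms(1) by simp
qed

lemma covering_number_if_lower_box_dim_greater:
  assumes "ereal t < lower_box_dim X F"
  shows "\<exists>d>0. \<forall>r. 0 < r \<and> r < d \<longrightarrow> r powr (- t) \<le> real (covering_number X r F)"
proof -
  have "eventually (\<lambda>r. ereal t < ereal (ln (real (covering_number X r F)) / (- ln r))) (at_right 0)"
    using assms unfolding lower_box_dim_def by (rule less_LiminfD)
  then obtain d where d: "0 < d"
    "\<And>r. 0 < r \<Longrightarrow> r < d \<Longrightarrow> t < ln (real (covering_number X r F)) / (- ln r)"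
    unfolding eventually_at_right_field by auto
  have "r powr (- t) \<le> real (covering_number X r F)" if r: "0 < r" "r < min d 1" for r
    using d(2)[of r] log_ratio_less_iff[OF r(1), of "covering_number X r F" t]
      covering_number_ge_1[OF X FX r(1) F_ne] r by simp
  then show ?thesis
    using d(1) by (intro exI[of _ "min d 1"]) simp
qed

lemma lower_box_dim_nonneg: "0 \<le> lower_box_dim X F"
  using lower_box_dim_ge[of 1 1 0 X F] covering_number_ge_1[OF X FX _ F_ne]
  by (simp add: zero_ereal_def)

text \<open>The largest radius \<open>\<rho>\<close> is kept fixed: the covering numbers of one ball of that radius are at most
  those of \<open>F\<close>.\<close>

lemma lower_dim_le_lower_box_dim: "lower_dim X F \<le> lower_box_dim X F"
  unfolding lower_dim_def
proof (rule Sup_least, safe)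
  fix \<alpha> C \<rho> :: real
  assume C: "0 < C" and \<rho>: "0 < \<rho>"
    and le: "\<forall>r R. 0 < r \<and> r < R \<and> R \<le> \<rho> \<longrightarrow>
     (INF x\<in>F. ereal (covering_number X r (cball x R \<inter> F))) \<ge> ereal (C * (R / r) powr \<alpha>)"
  obtain x where x: "x \<in> F"
    using F_ne by auto
  show "ereal \<alpha> \<le> lower_box_dim X F"
  proof (rule lower_box_dim_ge[OF \<rho>])
    show "0 < C * \<rho> powr \<alpha>"
      using C \<rho> by simp
    fix r assume r: "0 < r" "r < \<rho>"
    have "ereal (C * (\<rho> / r) powr \<alpha>) \<le> ereal (covering_number X r (cball x \<rho> \<inter> F))"
      using le r x by (meson INF_lower order_refl order_trans)
    also have "\<dots> \<le> ereal (covering_number X r F)"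
      using covering_number_mono[OF X FX r(1), of "cball x \<rho> \<inter> F"] by simp
    also have "C * (\<rho> / r) powr \<alpha> = C * \<rho> powr \<alpha> * r powr (- \<alpha>)"
      using r by (simp add: powr_divide powr_minus field_simps)
    finally show "C * \<rho> powr \<alpha> * r powr (- \<alpha>) \<le> real (covering_number X r F)"
      by simp
  qed
qed

text \<open>By compactness \<open>F\<close> is a finite union of balls of the fixed radius \<open>\<rho>\<close>, to each of which the Assouad
  bound applies.\<close>

lemma upper_box_dim_le_assouad_dim: "upper_box_dim X F \<le> assouad_dim X F"
  unfolding assouad_dim_def
proof (rule Inf_greatest, safe)
  fix \<alpha> C \<rho> :: real
  assume C: "0 < C" and \<rho>: "0 < \<rho>"
    and le: "\<forall>r R. 0 < r \<and> r < R \<and> R \<le> \<rho> \<longrightarrow>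
     (SUP x\<in>F. ereal (covering_number X r (cball x R \<inter> F))) \<le> ereal (C * (R / r) powr \<alpha>)"
  have "F \<subseteq> (\<Union>x\<in>F. ball x \<rho>)"
    using \<rho> by force
  then obtain k where k: "k \<subseteq> F" "finite k" "F \<subseteq> (\<Union>x\<in>k. ball x \<rho>)"
    using compactE_image[OF F, of F "\<lambda>x. ball x \<rho>"] by auto
  have "covering_growth F (real (card k) * C * \<rho> powr \<alpha>) \<alpha> \<rho>"
    unfolding covering_growth_def
  proof (intro allI impI, elim conjE)
    fix r assume r: "0 < r" "r < \<rho>"
    let ?N = "\<lambda>x. covering_number X r (cball x \<rho> \<inter> F)"
    have "coverable (\<Union>x\<in>k. cball x \<rho> \<inter> F) r (\<Sum>x\<in>k. ?N x)"
      using FX by (intro coverable_UN k coverable_covering_number X r) auto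
    then have "coverable F r (\<Sum>x\<in>k. ?N x)"
      by (rule coverable_mono) (use k(3) in \<open>auto simp: subset_iff less_imp_le\<close>, force)
    moreover have "real (\<Sum>x\<in>k. ?N x) \<le> (\<Sum>x\<in>k. C * (\<rho> / r) powr \<alpha>)"
      unfolding of_nat_sum
    proof (rule sum_mono)
      fix x assume "x \<in> k"
      then have "ereal (?N x) \<le> ereal (C * (\<rho> / r) powr \<alpha>)"
        using le r k(1) by (meson SUP_upper order_refl order_trans subsetD)
      then show "real (?N x) \<le> C * (\<rho> / r) powr \<alpha>"
        by simp
    qed
    moreover have "(\<Sum>x\<in>k. C * (\<rho> / r) powr \<alpha>) = real (card k) * C * \<rho> powr \<alpha> * r powr (- \<alpha>)"
      using r by (simp add: powr_divide powr_minus field_simps)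
    ultimately show "\<exists>n. coverable F r n \<and> real n \<le> real (card k) * C * \<rho> powr \<alpha> * r powr (- \<alpha>)"
      by (intro exI[of _ "\<Sum>x\<in>k. ?N x"] conjI) linarith+
  qed
  then show "upper_box_dim X F \<le> ereal \<alpha>"
    using \<rho> by (rule upper_box_dim_le_growth)
qed

text \<open>A cover by \<open>r powr (- t')\<close> sets of diameter at most \<open>r\<close> has \<open>t\<close>-content at most
  \<open>r powr (t - t')\<close>, and such covers exist for arbitrarily small \<open>r\<close>.\<close>

lemma hausdorff_dim_le_lower_box_dim: "hausdorff_dim F \<le> lower_box_dim X F"
proof (rule ereal_le_by_real_above)
  fix t assume "lower_box_dim X F < ereal t"
  then obtain t' where t': "lower_box_dim X F < ereal t'" "t' < t"
    using ereal_dense2 by force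
  then have "0 < t'"
    using lower_box_dim_nonneg order_le_less_trans by (metis ereal_less(2))
  have "hausdorff_premeasure t d F \<le> 0" if d: "0 < d" for d
  proof (rule ennreal_le_epsilon)
    fix e :: real assume e: "0 < e"
    obtain r n where rn: "0 < r" "r < min d (e powr (1 / (t - t')))"
      "coverable F r n" "real n \<le> r powr (- t')"
      using coverable_if_lower_box_dim_less[OF t'(1), of "min d (e powr (1 / (t - t')))"] d e by auto
    have "hausdorff_premeasure t d F \<le> hausdorff_premeasure t r F"
      using rn by (intro hausdorff_premeasure_antimono) simp
    also have "\<dots> \<le> ennreal (real n * r powr t)"
      using rn t' \<open>0 < t'\<close> by (intro hausdorff_premeasure_le_coverable) auto
    also have "\<dots> \<le> ennreal e"
    proof (rule ennreal_leI)
      have "real n * r powr t \<le> r powr (- t') * r powr t"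
        using rn by (intro mult_right_mono) auto
      also have "\<dots> = r powr (t - t')"
        by (simp add: powr_add[symmetric])
      also have "\<dots> \<le> (e powr (1 / (t - t'))) powr (t - t')"
        using rn t' by (intro powr_mono2) auto
      also have "\<dots> = e"
        using e t' by (simp add: powr_powr)
      finally show "real n * r powr t \<le> e" .
    qed
    finally show "hausdorff_premeasure t d F \<le> 0 + ennreal e"
      by simp
  qed
  then have "hausdorff_measure t F = 0"
    unfolding hausdorff_measure_def by (simp add: le_zero_eq[symmetric] SUP_le_iff del: le_zero_eq)
  then show "hausdorff_dim F \<le> ereal t"
    unfolding hausdorff_dim_def using t' \<open>0 < t'\<close> by (intro Inf_lower) auto
qed

end

section \<open>Packing dimension\<close>

text \<open>Greedy selection: separated points are added one at a time until there are \<open>m\<close> of them or the balls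
  around them cover \<open>A\<close>.\<close>

lemma separated_net:
  fixes A :: "'a::metric_space set"
  assumes "0 \<le> r"
  shows "\<exists>S\<subseteq>A. finite S \<and> pairwise (\<lambda>x y. r < dist x y) S \<and>
           (card S = m \<or> card S < m \<and> A \<subseteq> (\<Union>x\<in>S. cball x r))"
proof (induction m)
  case 0
  show ?case
    by (intro exI[of _ "{}"]) auto
next
  case (Suc m)
  then obtain S where S: "S \<subseteq> A" "finite S" "pairwise (\<lambda>x y. r < dist x y) S"
    "card S = m \<or> card S < m \<and> A \<subseteq> (\<Union>x\<in>S. cball x r)"
    by blast
  show ?case
  proof (cases "A \<subseteq> (\<Union>x\<in>S. cball x r)")
    case True
    then show ?thesis
      using S by (intro exI[of _ S]) auto
  next
    case False
    then obtain y where y: "y \<in> A" "\<And>x. x \<in> S \<Longrightarrow> r < dist x y"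
      by (force simp: not_le)
    have "card S = m"
      using S(4) False by blast
    moreover have "pairwise (\<lambda>x y. r < dist x y) (insert y S)"
      using S(3) y(2) by (auto simp: pairwise_insert dist_commute)
    moreover have "card (insert y S) = Suc (card S)"
      using y(2)[of y] assms S(2) by (auto simp: card_insert_if)
    ultimately show ?thesis
      using S(1,2) y(1) by (intro exI[of _ "insert y S"]) simp
  qed
qed

lemma separated_card_le:
  assumes "coverable A r n" "f ` Q \<subseteq> A" "pairwise (\<lambda>p q. r < dist (f p) (f q)) Q"
  shows "card Q \<le> n"
proof -
  obtain \<U> where U: "finite \<U>" "card \<U> \<le> n" "A \<subseteq> \<Union>\<U>" "\<forall>U\<in>\<U>. spread_le r U"
    using assms(1) unfolding coverable_def by blast
  have "\<forall>p\<in>Q. \<exists>U\<in>\<U>. f p \<in> U"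
    using assms(2) U(3) by blast
  then obtain h where h: "\<And>p. p \<in> Q \<Longrightarrow> h p \<in> \<U> \<and> f p \<in> h p"
    by metis
  have "inj_on h Q"
  proof (rule inj_onI, rule ccontr)
    fix p q assume pq: "p \<in> Q" "q \<in> Q" "h p = h q" "p \<noteq> q"
    then have "r < dist (f p) (f q)"
      using assms(3) by (auto simp: pairwise_def)
    moreover have "dist (f p) (f q) \<le> r"
      using h[OF pq(1)] h[OF pq(2)] pq(3) U(4) by (auto dest: spread_leD)
    ultimately show False
      by simp
  qed
  then show ?thesis
    using card_inj_on_le[of h Q \<U>] h U(1,2) by (meson image_subsetI order_trans)
qed

lemma separated_imp_packing:
  fixes X E :: "'a::metric_space set"
  assumes "finite S" "S \<subseteq> E" "pairwise (\<lambda>x y. 2 * r < dist x y) S" "0 < r" "r \<le> d"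
  shows "ennreal (real (card S) * (2 * r) powr s)
    \<le> (SUP P\<in>packings X d E. (\<Sum>\<^sub>\<infinity>(x, r)\<in>P. ennreal ((2 * r) powr s)))"
proof -
  let ?P = "(\<lambda>x. (x, r)) ` S"
  have "disjnt (cball x r \<inter> X) (cball y r \<inter> X)" if "2 * r < dist x y" for x y
  proof -
    have False if "z \<in> cball x r" "z \<in> cball y r" for z
      using that \<open>2 * r < dist x y\<close> dist_triangle2[of x y z] by simp
    then show ?thesis
      by (auto simp: disjnt_def)
  qed
  then have "?P \<in> packings X d E"
    using assms unfolding packings_def
    by (auto simp: pairwise_def intro: countable_finite)
  then have "(\<Sum>\<^sub>\<infinity>(x, r)\<in>?P. ennreal ((2 * r) powr s))
      \<le> (SUP P\<in>packings X d E. (\<Sum>\<^sub>\<infinity>(x, r)\<in>P. ennreal ((2 * r) powr s)))"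
    by (rule SUP_upper)
  also have "(\<Sum>\<^sub>\<infinity>(x, r)\<in>?P. ennreal ((2 * r) powr s)) = (\<Sum>x\<in>S. ennreal ((2 * r) powr s))"
    using assms(1) by (simp add: sum.reindex inj_on_def)
  also have "\<dots> = ennreal (real (card S) * (2 * r) powr s)"
    by (simp add: ennreal_mult ennreal_of_nat_eq_real_of_nat)
  finally show ?thesis .
qed

text \<open>Take points of \<open>E\<close> at mutual distances above \<open>2 \<eta>\<close>. The balls of radius \<open>\<eta>\<close> around them form a
  packing, so that there are boundedly many of them unless the packing sums are infinite, and for a
  maximal choice the balls of radius \<open>2 \<eta>\<close> form a cover. The two contents differ by the factor
  \<open>2 powr s\<close>.\<close>

lemma hausdorff_premeasure_le_packing:
  fixes X E :: "'a::metric_space set"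
  assumes "0 < d" "0 \<le> s"
  shows "ennreal (2 powr (- s)) * hausdorff_premeasure s d E \<le> packing_premeasure X s E"
  unfolding packing_premeasure_def
proof (rule INF_greatest)
  fix \<delta> :: real assume "\<delta> \<in> {0<..}"
  define \<eta> where "\<eta> = min \<delta> (d / 4)"
  have \<eta>: "0 < \<eta>" "\<eta> \<le> \<delta>" "4 * \<eta> \<le> d"
    using assms(1) \<open>\<delta> \<in> {0<..}\<close> by (auto simp: \<eta>_def)
  let ?T = "SUP P\<in>packings X \<delta> E. (\<Sum>\<^sub>\<infinity>(x, r)\<in>P. ennreal ((2 * r) powr s))"
  show "ennreal (2 powr (- s)) * hausdorff_premeasure s d E \<le> ?T"
  proof (cases "?T = top")
    case True
    show ?thesis
      unfolding True by (rule top_greatest)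
  next
    case False
    then obtain T where T: "?T = ennreal T" "0 \<le> T"
      by (cases ?T rule: ennreal_cases) auto
    obtain m :: nat where m: "T / (2 * \<eta>) powr s < real m"
      using reals_Archimedean2 by blast
    obtain S where S: "S \<subseteq> E" "finite S" "pairwise (\<lambda>x y. 2 * \<eta> < dist x y) S"
      "card S = m \<or> E \<subseteq> (\<Union>x\<in>S. cball x (2 * \<eta>))"
        using separated_net[of "2 * \<eta>" E m] \<eta>(1) by auto
    have le: "ennreal (real (card S) * (2 * \<eta>) powr s) \<le> ?T"
      by (rule separated_imp_packing[OF S(2,1,3) \<eta>(1,2)])
    then have "real (card S) * (2 * \<eta>) powr s \<le> T"
      using T by (simp add: ennreal_le_iff)
    then have "card S \<noteq> m"
      using m \<eta>(1) by (auto simp: field_simps)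
    then have "coverable E (2 * (2 * \<eta>)) (card S)"
      using S(2,4) by (intro coverable_centres) auto
    then have "coverable E (4 * \<eta>) (card S)"
      by (simp add: mult.assoc[symmetric])
    then have "hausdorff_premeasure s (4 * \<eta>) E \<le> ennreal (real (card S) * (4 * \<eta>) powr s)"
      using \<eta>(1) assms(2) by (intro hausdorff_premeasure_le_coverable) auto
    then have "hausdorff_premeasure s d E \<le> ennreal (real (card S) * (4 * \<eta>) powr s)"
      using hausdorff_premeasure_antimono[OF \<eta>(3)] order_trans by blast
    then have "ennreal (2 powr (- s)) * hausdorff_premeasure s d E
        \<le> ennreal (2 powr (- s)) * ennreal (real (card S) * (4 * \<eta>) powr s)"
      by (rule mult_left_mono) simp
    also have "\<dots> = ennreal (real (card S) * (2 * \<eta>) powr s)"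
    proof -
      have "(4 * \<eta>) powr s = 2 powr s * (2 * \<eta>) powr s"
        using \<eta>(1) by (simp flip: powr_mult)
      then show ?thesis
        by (simp flip: ennreal_mult add: powr_minus)
    qed
    finally show ?thesis
      using le by (rule order_trans)
  qed
qed

lemma hausdorff_dim_le_packing_dim: "hausdorff_dim F \<le> packing_dim X F"
  unfolding hausdorff_dim_def packing_dim_def
proof (rule Inf_superset_mono, rule image_mono, rule subsetI)
  fix s :: real assume "s \<in> {s. 0 \<le> s \<and> packing_measure X s F = 0}"
  then have s: "0 \<le> s" and zero: "packing_measure X s F = 0"
    by auto
  have "hausdorff_premeasure s d F = 0" if d: "0 < d" for d
  proof -
    have "ennreal (2 powr (- s)) * hausdorff_premeasure s d F \<le> packing_measure X s F"
      unfolding packing_measure_def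
    proof (rule INF_greatest)
      fix E :: "nat \<Rightarrow> 'a set"
      assume "E \<in> {E. F \<subseteq> (\<Union>i. E i) \<and> (\<forall>i. E i \<subseteq> X)}"
      then have "hausdorff_premeasure s d F \<le> (\<Sum>i. hausdorff_premeasure s d (E i))"
        by (intro hausdorff_premeasure_subadditive) auto
      then have "ennreal (2 powr (- s)) * hausdorff_premeasure s d F
          \<le> ennreal (2 powr (- s)) * (\<Sum>i. hausdorff_premeasure s d (E i))"
        by (rule mult_left_mono) simp
      also have "\<dots> = (\<Sum>i. ennreal (2 powr (- s)) * hausdorff_premeasure s d (E i))"
        by simp
      also have "\<dots> \<le> (\<Sum>i. packing_premeasure X s (E i))"
        by (intro suminf_le hausdorff_premeasure_le_packing d s) auto
      finally show "ennreal (2 powr (- s)) * hausdorff_premeasure s d F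
          \<le> (\<Sum>i. packing_premeasure X s (E i))" .
    qed
    then show ?thesis
      using zero by simp
  qed
  then show "s \<in> {s. 0 \<le> s \<and> hausdorff_measure s F = 0}"
    using s unfolding hausdorff_measure_def by (simp add: image_constant_conv)
qed

lemma packing_premeasure_empty: "packing_premeasure X s {} = 0"
proof -
  have "packings X d {} = {{}}" for d
    unfolding packings_def by auto
  then show ?thesis
    unfolding packing_premeasure_def by simp
qed

lemma packing_measure_le_premeasure:
  assumes "F \<subseteq> X"
  shows "packing_measure X s F \<le> packing_premeasure X s F"
proof -
  let ?E = "\<lambda>i::nat. if i = 0 then F else {}"
  have "packing_measure X s F \<le> (\<Sum>i. packing_premeasure X s (?E i))"
    unfolding packing_measure_def
    by (rule INF_lower) (use assms in auto)
  also have "\<dots> = (\<Sum>i\<in>{0}. packing_premeasure X s (?E i))"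
    by (rule suminf_finite) (auto simp: packing_premeasure_empty)
  finally show ?thesis
    by simp
qed

lemma sum_powers_le_tail:
  fixes q :: real
  assumes "0 \<le> q" "q < 1" "finite K" "\<And>k. k \<in> K \<Longrightarrow> k0 \<le> k"
  shows "(\<Sum>k\<in>K. q ^ k) \<le> q ^ k0 / (1 - q)"
proof -
  have "(\<Sum>k\<in>K. q ^ k) = (\<Sum>k\<in>K. q ^ k0 * q ^ (k - k0))"
    using assms(4) by (intro sum.cong) (auto simp flip: power_add)
  also have "\<dots> = q ^ k0 * (\<Sum>j\<in>(\<lambda>k. k - k0) ` K. q ^ j)"
    using assms(4) by (subst sum.reindex) (auto simp: inj_on_def sum_distrib_left eq_diff_iff)
  also have "\<dots> \<le> q ^ k0 * (\<Sum>j. q ^ j)"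
    using assms by (intro mult_left_mono sum_le_suminf summable_geometric) auto
  also have "\<dots> = q ^ k0 / (1 - q)"
    using assms by (simp add: suminf_geometric)
  finally show ?thesis .
qed

text \<open>The balls of a packing are grouped by the dyadic size of their radii. Disjoint balls with radii in
  \<open>(2 powr (- k - 1), 2 powr (- k)]\<close> have centres at mutual distances above \<open>2 powr (- k - 1)\<close>, so
  their number is at most the covering number at that scale. The groups then
  contribute the terms of a geometric series with ratio \<open>2 powr (u - t) < 1\<close>.\<close>

lemma packing_sum_le:
  assumes growth: "covering_growth F C u d" and C: "0 \<le> C"
    and FX: "F \<subseteq> X" and u: "u < t" "0 \<le> t" and k0: "2 powr (- real k0) \<le> d"
    and P: "P \<in> packings X (2 powr (- real k0)) F" and Q: "finite Q" "Q \<subseteq> P"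
  shows "(\<Sum>(x, r)\<in>Q. (2 * r) powr t)
    \<le> C * 2 powr (u + t) * ((2 powr (u - t)) ^ k0 / (1 - 2 powr (u - t)))"
proof -
  let ?q = "2 powr (u - t)"
  define \<kappa> where "\<kappa> p = nat \<lfloor>- log 2 (snd p)\<rfloor>" for p :: "'a \<times> real"
  have QD: "x \<in> F" "0 < r" "r \<le> 2 powr (- real k0)" if "(x, r) \<in> Q" for x r
    using that P Q(2) unfolding packings_def by auto
  have \<kappa>: "k0 \<le> \<kappa> (x, r)" "2 powr (- real (\<kappa> (x, r)) - 1) < r" "r \<le> 2 powr (- real (\<kappa> (x, r)))"
    if xr: "(x, r) \<in> Q" for x r
  proof -
    have "log 2 r \<le> - real k0"
      using QD[OF xr] by (simp add: log_le_iff)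
    then have fl: "int k0 \<le> \<lfloor>- log 2 r\<rfloor>"
      by linarith
    then show "k0 \<le> \<kappa> (x, r)"
      by (simp add: \<kappa>_def le_nat_iff)
    have k_eq: "real (\<kappa> (x, r)) = of_int \<lfloor>- log 2 r\<rfloor>"
      using fl by (simp add: \<kappa>_def)
    have "- real (\<kappa> (x, r)) - 1 < log 2 r" "log 2 r \<le> - real (\<kappa> (x, r))"
      unfolding k_eq by linarith+
    then show "2 powr (- real (\<kappa> (x, r)) - 1) < r" "r \<le> 2 powr (- real (\<kappa> (x, r)))"
      using QD(2)[OF xr] by (simp_all add: less_log_iff log_le_iff)
  qed
  have block: "(\<Sum>(x, r)\<in>{p\<in>Q. \<kappa> p = k}. (2 * r) powr t) \<le> C * 2 powr (u + t) * ?q ^ k"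
    if k: "k \<in> \<kappa> ` Q" for k
  proof -
    let ?B = "{p\<in>Q. \<kappa> p = k}"
    have "k0 \<le> k"
      using k \<kappa>(1) by auto
    then have "2 powr (- real k - 1) < 2 powr (- real k0)"
      by (intro powr_less_mono) auto
    then have "2 powr (- real k - 1) < d"
      using k0 by (rule order_less_le_trans)
    then have "0 < 2 powr (- real k - 1) \<and> 2 powr (- real k - 1) < d"
      by simp
    then obtain n where n: "coverable F (2 powr (- real k - 1)) n"
      "real n \<le> C * (2 powr (- real k - 1)) powr (- u)"
      using growth unfolding covering_growth_def by blast
    have "card ?B \<le> n"
    proof (rule separated_card_le[OF n(1), of fst])
      show "fst ` ?B \<subseteq> F"
        using QD(1) by auto
      show "pairwise (\<lambda>p q. 2 powr (- real k - 1) < dist (fst p) (fst q)) ?B"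
      proof (rule pairwiseI)
        fix p p' assume pp: "p \<in> ?B" "p' \<in> ?B" "p \<noteq> p'"
        obtain x r y r' where p_def: "p = (x, r)" "p' = (y, r')"
          by (cases p, cases p')
        have xr: "(x, r) \<in> Q" "\<kappa> (x, r) = k" and yr: "(y, r') \<in> Q" and ne: "(x, r) \<noteq> (y, r')"
          using pp p_def by auto
        have "pairwise (\<lambda>(x, r) (y, t). disjnt (cball x r \<inter> X) (cball y t \<inter> X)) P"
          using P unfolding packings_def by blast
        from pairwiseD[OF this, of "(x, r)" "(y, r')"] xr(1) yr(1) ne Q(2)
        have "disjnt (cball x r \<inter> X) (cball y r' \<inter> X)"
          by auto
        moreover have "y \<in> cball y r' \<inter> X"
          using QD[OF yr(1)] FX by auto
        ultimately have "y \<notin> cball x r"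
          by (auto simp: disjnt_iff)
        then show "2 powr (- real k - 1) < dist (fst p) (fst p')"
          using \<kappa>(2)[OF xr(1)] xr(2) p_def by simp
      qed
    qed
    have "(\<Sum>(x, r)\<in>?B. (2 * r) powr t) \<le> (\<Sum>p\<in>?B. (2 * 2 powr (- real k)) powr t)"
    proof (rule sum_mono, clarify)
      fix x r assume xr: "(x, r) \<in> Q" "k = \<kappa> (x, r)"
      show "(2 * r) powr t \<le> (2 * 2 powr (- real (\<kappa> (x, r)))) powr t"
        using \<kappa>(3)[OF xr(1)] QD(2)[OF xr(1)] u(2) by (intro powr_mono2) auto
    qed
    also have "\<dots> = real (card ?B) * (2 powr (1 - real k)) powr t"
      by (simp add: powr_diff powr_minus divide_inverse)
    also have "\<dots> \<le> C * (2 powr (- real k - 1)) powr (- u) * (2 powr (1 - real k)) powr t"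
      using \<open>card ?B \<le> n\<close> n(2) by (intro mult_right_mono) auto
    also have "\<dots> = C * 2 powr ((- real k - 1) * (- u) + (1 - real k) * t)"
      by (simp only: powr_powr powr_add mult.assoc)
    also have "(- real k - 1) * (- u) + (1 - real k) * t = (u + t) + (u - t) * real k"
      by (simp add: algebra_simps)
    also have "C * 2 powr ((u + t) + (u - t) * real k) = C * 2 powr (u + t) * ?q ^ k"
      by (simp add: powr_add[of 2 "u + t" "(u - t) * real k"]
          powr_powr[of 2 "u - t" "real k", symmetric] powr_realpow)
    finally show ?thesis .
  qed
  have "(\<Sum>(x, r)\<in>Q. (2 * r) powr t) = (\<Sum>k\<in>\<kappa> ` Q. \<Sum>(x, r)\<in>{p\<in>Q. \<kappa> p = k}. (2 * r) powr t)"
    by (rule sum.image_gen[OF Q(1)])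
  also have "\<dots> \<le> (\<Sum>k\<in>\<kappa> ` Q. C * 2 powr (u + t) * ?q ^ k)"
    by (rule sum_mono) (rule block)
  also have "\<dots> = C * 2 powr (u + t) * (\<Sum>k\<in>\<kappa> ` Q. ?q ^ k)"
    by (simp add: sum_distrib_left)
  also have "\<dots> \<le> C * 2 powr (u + t) * (?q ^ k0 / (1 - ?q))"
  proof (intro mult_left_mono sum_powers_le_tail)
    show "?q < 1"
      using u(1) powr_less_mono[of "u - t" 0 2] by simp
  qed (use C Q(1) \<kappa>(1) in auto)
  finally show ?thesis .
qed

lemma packing_premeasure_zero:
  assumes growth: "covering_growth F C u d" and "0 \<le> C" "0 < d"
    and FX: "F \<subseteq> X" and u: "u < t" "0 \<le> t"
  shows "packing_premeasure X t F = 0"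
proof -
  let ?q = "2 powr (u - t)"
  define B where "B k = C * 2 powr (u + t) * (?q ^ k / (1 - ?q))" for k
  have q: "?q < 1"
    using u(1) powr_less_mono[of "u - t" 0 2] by simp
  have "(\<lambda>k. C * 2 powr (u + t) * (?q ^ k / (1 - ?q))) \<longlonglongrightarrow> C * 2 powr (u + t) * (0 / (1 - ?q))"
    using q by (intro tendsto_intros LIMSEQ_realpow_zero) auto
  then have B0: "B \<longlonglongrightarrow> 0"
    unfolding B_def by simp
  have pow0: "(\<lambda>k. 2 powr (- real k)) \<longlonglongrightarrow> 0"
  proof -
    have "2 powr (- real k) = (1 / 2 :: real) ^ k" for k
      by (simp only: powr_minus powr_realpow power_one_over inverse_eq_divide zero_less_numeral)
    then show ?thesis
      using LIMSEQ_realpow_zero[of "1 / 2"] by simp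
  qed
  have "packing_premeasure X t F \<le> 0"
  proof (rule ennreal_le_epsilon)
    fix e :: real assume e: "0 < e"
    have "eventually (\<lambda>k. B k < e \<and> 2 powr (- real k) < d) sequentially"
      using order_tendstoD(2)[OF B0 e] order_tendstoD(2)[OF pow0 \<open>0 < d\<close>] by (rule eventually_conj)
    then obtain k where k: "B k < e" "2 powr (- real k) < d"
      using eventually_happens by fastforce
    have "packing_premeasure X t F
        \<le> (SUP P\<in>packings X (2 powr (- real k)) F. (\<Sum>\<^sub>\<infinity>(x, r)\<in>P. ennreal ((2 * r) powr t)))"
      unfolding packing_premeasure_def by (rule INF_lower) simp
    also have "\<dots> \<le> ennreal e"
    proof (rule SUP_least)
      fix P assume P: "P \<in> packings X (2 powr (- real k)) F"
      have "(\<Sum>(x, r)\<in>Q. ennreal ((2 * r) powr t)) \<le> ennreal e" if Q: "finite Q" "Q \<subseteq> P" for Q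
      proof -
        have "(\<Sum>(x, r)\<in>Q. ennreal ((2 * r) powr t)) = ennreal (\<Sum>(x, r)\<in>Q. (2 * r) powr t)"
          by (simp add: case_prod_beta sum_ennreal)
        also have "\<dots> \<le> ennreal (B k)"
          unfolding B_def using packing_sum_le[OF growth \<open>0 \<le> C\<close> FX u _ P Q] k(2)
          by (intro ennreal_leI) simp
        also have "\<dots> \<le> ennreal e"
          using k(1) by (intro ennreal_leI) simp
        finally show ?thesis .
      qed
      then show "(\<Sum>\<^sub>\<infinity>(x, r)\<in>P. ennreal ((2 * r) powr t)) \<le> ennreal e"
        by (subst nonneg_infsum_complete) (auto intro!: SUP_least)
    qed
    finally show "packing_premeasure X t F \<le> 0 + ennreal e"
      by simp
  qed
  then show ?thesis
    by simp
qed

lemma packing_dim_le_upper_box_dim: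
  assumes "compact X" "F \<subseteq> X" "compact F" "F \<noteq> {}"
  shows "packing_dim X F \<le> upper_box_dim X F"
proof (rule ereal_le_by_real_above)
  fix t assume "upper_box_dim X F < ereal t"
  then obtain u where u: "upper_box_dim X F < ereal u" "u < t"
    using ereal_dense2 by force
  then have "0 < ereal u"
    using lower_box_dim_nonneg[OF assms] lower_box_dim_le_upper order_le_less_trans order_trans by metis
  then have "0 < u"
    by simp
  obtain d where "0 < d" "covering_growth F 1 u d"
    using growth_if_upper_box_dim_less[OF assms u(1)] by blast
  then have "packing_premeasure X t F = 0"
    using packing_premeasure_zero[of F 1 u d X t] assms u(2) \<open>0 < u\<close> by simp
  then have "packing_measure X t F = 0"
    using packing_measure_le_premeasure[OF assms(2), of t] by simp
  then show "packing_dim X F \<le> ereal t"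
    unfolding packing_dim_def using u \<open>0 < u\<close> by (intro Inf_lower) auto
qed

section \<open>Small pieces that expand into the whole set\<close>

lemma expands_mono: "expands c f A \<Longrightarrow> c' \<le> c \<Longrightarrow> expands c' f A"
  unfolding expands_def by (meson mult_right_mono order_trans zero_le_dist)

text \<open>The number \<open>w\<close> may exceed the diameter, so that the case of a single point, which \<^const>\<open>Q1\<close> leaves
  out, is included: there the identity will do.\<close>

lemma Q1_map:
  assumes "Q1 X F a r0" "0 < a" "F \<subseteq> X" "U \<subseteq> F" "spread_le w U" "0 < w" "w \<le> r0"
  obtains g where "g \<in> U \<rightarrow> F" "expands (a / w) g U"
proof (cases "diameter U = 0")
  case True
  have "x = y" if "x \<in> U" "y \<in> U" for x y
    using diameter_bounded_bound[OF spread_le_imp_bounded[OF assms(5)] that] True by simp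
  then have "a / w * dist x y \<le> dist (id x) (id y)" if "x \<in> U" "y \<in> U" for x y
    using that by (metis dist_self mult_zero_right order_refl)
  then have "expands (a / w) id U"
    by (simp add: expands_def)
  then show ?thesis
    using that[of id] assms(4) by (auto simp: Pi_def subset_iff)
next
  case False
  let ?d = "diameter U"
  have d: "0 < ?d" "?d \<le> w"
    using False diameter_ge_0[OF spread_le_imp_bounded[OF assms(5)]]
      diameter_le_spread[OF assms(5)] assms(6) by auto
  have U: "F \<inter> U = U" "U \<noteq> {}"
    using assms(4) False by auto
  then have "\<exists>g \<in> F \<inter> U \<rightarrow> F. \<forall>x\<in>F \<inter> U. \<forall>y\<in>F \<inter> U. a * inverse ?d * dist x y \<le> dist (g x) (g y)"
    using assms(1)[unfolded Q1_def, rule_format, of U] assms(3,4,7) d by auto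
  then obtain g where g: "g \<in> U \<rightarrow> F" "expands (a / ?d) g U"
    unfolding U(1) expands_def divide_inverse by blast
  moreover have "a / w \<le> a / ?d"
    using d assms(2) by (intro divide_left_mono) auto
  ultimately show ?thesis
    using that expands_mono by blast
qed

text \<open>Each piece \<open>U i \<inter> F\<close> expands by \<open>a / w i > 1\<close> into \<open>F\<close>, so a cover of \<open>F\<close> at the coarser scale
  \<open>r (a / w i)\<close> pulls back to a cover of the piece at scale \<open>r\<close>. If \<open>C r powr (- t)\<close> bounds the
  covering numbers at coarser scales, then at scale \<open>r\<close> they are bounded by
  \<open>C r powr (- t) * (\<Sum>i\<in>I. (w i / a) powr t)\<close>, which reproduces the bound.\<close>

lemma Q1_growth:
  fixes U :: "'i \<Rightarrow> 'a::metric_space set"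
  assumes Q1: "Q1 X F a r0" and a: "0 < a" and FX: "F \<subseteq> X" and F: "compact F" "F \<noteq> {}"
    and I: "finite I" and cover: "F \<subseteq> (\<Union>i\<in>I. U i)"
    and w: "\<And>i. i \<in> I \<Longrightarrow> 0 < w i \<and> w i \<le> r0 \<and> w i < a \<and> spread_le (w i) (U i)"
    and t: "0 \<le> t" and le1: "(\<Sum>i\<in>I. (w i / a) powr t) \<le> 1"
  shows "\<exists>C>0. covering_growth F C t 1"
proof -
  have I_ne: "I \<noteq> {}"
    using cover F(2) by auto
  \<comment> \<open>One step of the recursion coarsens the scale at most by the factor \<open>K\<close> and at least by
    \<open>1 / c\<close>: started below \<open>1\<close> it stays below \<open>K\<close>, and it leaves \<open>(0, 1)\<close> after finitely many steps.\<close>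
  define K where "K = a / Min (w ` I)"
  define c where "c = Max (w ` I) / a"
  have "Min (w ` I) \<in> w ` I" "Max (w ` I) \<in> w ` I"
    using I I_ne by auto
  then have ends: "0 < Min (w ` I)" "Min (w ` I) < a" "0 < Max (w ` I)" "Max (w ` I) < a"
    using w by auto
  have K: "1 < K"
    using ends a unfolding K_def by auto
  have K_ge: "a / w i \<le> K" if "i \<in> I" for i
    using ends a I that w[OF that] unfolding K_def by (auto intro!: divide_left_mono)
  have c: "0 < c" "c < 1"
    using ends a unfolding c_def by auto
  have c_ge: "w i / a \<le> c" if "i \<in> I" for i
    using I a that unfolding c_def by (intro divide_right_mono) auto
  obtain n0 where n0: "coverable F 1 n0"
    using compact_imp_coverable[OF F(1)] zero_less_one by blast
  then have "0 < n0"
    using coverable_pos F(2) by blast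
  define C where "C = real n0 * K powr t"
  have C: "0 < C"
    using \<open>0 < n0\<close> K by (simp add: C_def)
  have coarse: "\<exists>n. coverable F r n \<and> real n \<le> C * r powr (- t)" if "1 \<le> r" "r \<le> K" for r
  proof -
    have "1 \<le> K powr t * r powr (- t)"
      using that t by (simp add: powr_minus field_simps powr_mono2)
    then have "real n0 * 1 \<le> real n0 * (K powr t * r powr (- t))"
      by (rule mult_left_mono) simp
    moreover have "coverable F r n0"
      using n0 that by (auto intro: coverable_mono)
    ultimately show ?thesis
      unfolding C_def by (intro exI[of _ n0]) (simp add: mult.assoc)
  qed
  have fine: "\<exists>n. coverable F r n \<and> real n \<le> C * r powr (- t)" if "0 < r" "r \<le> K" "c ^ m \<le> r" for r m
    using that
  proof (induction m arbitrary: r)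
    case 0
    then show ?case
      using coarse by simp
  next
    case (Suc m)
    show ?case
    proof (cases "1 \<le> r")
      case True
      then show ?thesis
        using coarse Suc.prems by simp
    next
      case False
      have "\<exists>n. coverable (U i \<inter> F) r n \<and> real n \<le> C * (r * (a / w i)) powr (- t)" if i: "i \<in> I" for i
      proof -
        let ?r = "r * (a / w i)"
        have wi: "0 < w i"
          using w[OF i] by simp
        have "c ^ m * c \<le> r"
          using Suc.prems(3) by (simp add: mult.commute)
        then have "c ^ m \<le> r / c"
          using c(1) by (simp add: field_simps)
        also have "\<dots> \<le> r / (w i / a)"
          using c_ge[OF i] Suc.prems(1) wi a c(1) by (intro divide_left_mono) auto
        finally have "c ^ m \<le> ?r"
          by simp
        moreover have "?r \<le> K"
          using K_ge[OF i] False Suc.prems(1) mult_mono[of r 1 "a / w i" K] wi a by simp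
        ultimately obtain n where n: "coverable F ?r n" "real n \<le> C * ?r powr (- t)"
          using Suc.IH[of ?r] Suc.prems(1) wi a by auto
        obtain g where g: "g \<in> U i \<inter> F \<rightarrow> F" "expands (a / w i) g (U i \<inter> F)"
          using Q1_map[OF Q1 a FX, of "U i \<inter> F" "w i"] w[OF i] by (auto intro: spread_le_mono)
        have "coverable (U i \<inter> F) (?r / (a / w i)) n"
          using g n(1) wi a by (intro coverable_preimage) auto
        then show ?thesis
          using n(2) wi a by auto
      qed
      then obtain n where n: "\<And>i. i \<in> I \<Longrightarrow> coverable (U i \<inter> F) r (n i)"
        "\<And>i. i \<in> I \<Longrightarrow> real (n i) \<le> C * (r * (a / w i)) powr (- t)"
        by metis
      have "coverable F r (\<Sum>i\<in>I. n i)"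
        by (rule coverable_mono[OF coverable_UN[OF I n(1)]]) (use cover in auto)
      moreover have "real (\<Sum>i\<in>I. n i) \<le> C * r powr (- t)"
      proof -
        have "real (\<Sum>i\<in>I. n i) \<le> (\<Sum>i\<in>I. C * (r * (a / w i)) powr (- t))"
          unfolding of_nat_sum by (rule sum_mono) (rule n(2))
        also have "\<dots> = (\<Sum>i\<in>I. C * r powr (- t) * (w i / a) powr t)"
        proof (rule sum.cong)
          fix i assume "i \<in> I"
          then have "0 < w i"
            using w by auto
          then have "(r * (a / w i)) powr (- t) = r powr (- t) * (w i / a) powr t"
            using a Suc.prems(1) by (simp add: powr_mult powr_divide powr_minus field_simps)
          then show "C * (r * (a / w i)) powr (- t) = C * r powr (- t) * (w i / a) powr t"
            by simp
        qed simp
        also have "\<dots> = C * r powr (- t) * (\<Sum>i\<in>I. (w i / a) powr t)"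
          by (simp add: sum_distrib_left)
        also have "\<dots> \<le> C * r powr (- t) * 1"
          using le1 C by (intro mult_left_mono) auto
        finally show ?thesis
          by simp
      qed
      ultimately show ?thesis
        by blast
    qed
  qed
  have "covering_growth F C t 1"
    unfolding covering_growth_def
  proof (intro allI impI, elim conjE)
    fix r :: real assume r: "0 < r" "r < 1"
    obtain m where "c ^ m < r"
      using real_arch_pow_inv[OF r(1) c(2)] by blast
    then show "\<exists>n. coverable F r n \<and> real n \<le> C * r powr (- t)"
      using fine[of r m] r K by simp
  qed
  then show ?thesis
    using C by blast
qed

text \<open>A set in a ball of radius \<open>R\<close> expands by \<open>a / (2 R)\<close> into \<open>F\<close>, so a cover of \<open>F\<close> at scale
  proportional to \<open>r / R\<close> pulls back to a cover of the trace of the ball at scale \<open>r / 2\<close>, half of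
  \<open>r\<close> because the covering number asks for open sets.\<close>

lemma Q1_assouad_dim_le:
  assumes Q1: "Q1 X F a r0" and a: "0 < a" and r0: "0 < r0"
    and FX: "F \<subseteq> X" and growth: "covering_growth F C t 1" and C: "0 < C"
  shows "assouad_dim X F \<le> ereal t"
proof -
  \<comment> \<open>Lowering the expansion constant to at most \<open>1\<close> keeps the scale \<open>b r / (4 R)\<close> below \<open>1\<close>, where the
    growth bound is available.\<close>
  define b where "b = min a 1"
  have b: "0 < b" "b \<le> a" "b \<le> 1"
    using a by (auto simp: b_def)
  have "(SUP x\<in>F. ereal (covering_number X r (cball x R \<inter> F))) \<le> ereal (C * (4 / b) powr t * (R / r) powr t)"
    if r: "0 < r" "r < R" "R \<le> r0 / 2" for r R
  proof (rule SUP_least)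
    fix x assume "x \<in> F"
    let ?U = "cball x R \<inter> F" and ?r = "b * r / (4 * R)"
    obtain g where g: "g \<in> ?U \<rightarrow> F" "expands (a / (2 * R)) g ?U"
      using Q1_map[OF Q1 a FX _ spread_le_cball[of R x F]] r by auto
    then have g': "expands (b / (2 * R)) g ?U"
      using b r by (intro expands_mono[OF g(2)] divide_right_mono) auto
    have "b * r < 1 * (4 * R)"
      using b r by (intro mult_le_less_imp_less) auto
    then have "0 < ?r \<and> ?r < 1"
      using b r by auto
    then obtain n where n: "coverable F ?r n" "real n \<le> C * ?r powr (- t)"
      using growth unfolding covering_growth_def by blast
    have "coverable ?U (?r / (b / (2 * R))) n"
      using b r by (intro coverable_preimage[OF g' g(1) _ n(1)]) auto
    moreover have "?r / (b / (2 * R)) = r / 2"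
      using b r by (simp add: field_simps)
    ultimately have "coverable ?U (r / 2) n"
      by (simp only:)
    then have "covering_number X (2 * (r / 2)) ?U \<le> n"
      using FX r by (intro covering_number_le) auto
    moreover have "?r powr (- t) = (4 / b) powr t * (R / r) powr t"
      using b r by (simp add: powr_mult powr_divide powr_minus field_simps)
    ultimately show "ereal (covering_number X r ?U) \<le> ereal (C * (4 / b) powr t * (R / r) powr t)"
      using n(2) by (simp add: mult.assoc)
  qed
  moreover have "0 < C * (4 / b) powr t" "0 < r0 / 2"
    using C b r0 by auto
  ultimately have "t \<in> {\<alpha>. \<exists>C>0. \<exists>\<rho>>0. \<forall>r R. 0 < r \<and> r < R \<and> R \<le> \<rho> \<longrightarrow>
     (SUP x\<in>F. ereal (covering_number X r (cball x R \<inter> F))) \<le> ereal (C * (R / r) powr \<alpha>)}"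
    by blast
  then show ?thesis
    unfolding assouad_dim_def by (intro Inf_lower) auto
qed

text \<open>Any finite cover by pieces with \<open>w \<le> a / 2\<close> serves: the sum in \<open>Q1_growth\<close> is at most
  \<open>n / 2 powr t\<close> for \<open>n\<close> pieces, hence at most \<open>1\<close> for \<open>t = n\<close>.\<close>

lemma Q1_assouad_dim_finite:
  assumes Q1: "Q1 X F a r0" and a: "0 < a" and r0: "0 < r0"
    and FX: "F \<subseteq> X" and F: "compact F" "F \<noteq> {}"
  shows "assouad_dim X F < \<infinity>"
proof -
  define w where "w = min (a / 2) r0"
  have w: "0 < w" "w \<le> r0" "w \<le> a / 2"
    using a r0 by (auto simp: w_def)
  obtain n where "coverable F w n"
    using compact_imp_coverable[OF F(1) w(1)] by blast
  then obtain \<U> where U: "finite \<U>" "card \<U> \<le> n" "F \<subseteq> \<Union>\<U>" "\<forall>U\<in>\<U>. spread_le w U"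
    unfolding coverable_def by blast
  have "(\<Sum>U\<in>\<U>. (w / a) powr real n) \<le> (\<Sum>U\<in>\<U>. (1 / 2) powr real n)"
    using w a by (intro sum_mono powr_mono2) (auto simp: field_simps)
  also have "\<dots> = real (card \<U>) * (1 / 2) ^ n"
    by (simp add: powr_realpow)
  also have "\<dots> \<le> 2 ^ n * (1 / 2) ^ n"
  proof (rule mult_right_mono)
    show "real (card \<U>) \<le> 2 ^ n"
      using U(2) of_nat_less_two_power[of n, where ?'a = real] by linarith
  qed simp
  also have "\<dots> = 1"
    by (simp flip: power_mult_distrib)
  finally have "\<exists>C>0. covering_growth F C (real n) 1"
    using Q1_growth[OF Q1 a FX F U(1), of "\<lambda>U. U" "\<lambda>_. w" "real n"] U(3,4) w a by auto
  then have "assouad_dim X F \<le> ereal (real n)"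
    using Q1_assouad_dim_le[OF Q1 a r0 FX] by blast
  then show ?thesis
    by (rule order_le_less_trans) simp
qed

text \<open>The strict inequality is the point. It comes from the cover being finite: its normalised
  \<open>s\<close>-content is below \<open>1\<close> and depends continuously on the exponent, which can therefore be
  lowered. It excludes that the measure vanishes at the critical exponent.\<close>

lemma Q1_assouad_dim_less:
  assumes Q1: "Q1 X F a r0" and a: "0 < a" and r0: "0 < r0"
    and FX: "F \<subseteq> X" and F: "compact F" "F \<noteq> {}"
    and s: "0 \<le> s" and zero: "hausdorff_measure s F = 0"
  shows "assouad_dim X F < ereal s"
proof -
  define c where "c = min a r0"
  have c: "0 < c" "c \<le> a" "c \<le> r0"
    using a r0 by (auto simp: c_def)
  have "hausdorff_premeasure s 1 F < ennreal (c powr s)"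
    using hausdorff_premeasure_le_measure[of 1 s F] zero c(1) by simp
  then obtain I :: "nat set" and V w where I: "finite I" "F \<subseteq> (\<Union>i\<in>I. V i)"
    and w: "\<And>i. i \<in> I \<Longrightarrow> 0 < w i \<and> spread_le (w i) (V i)" and sum: "(\<Sum>i\<in>I. w i powr s) < c powr s"
    using finite_cover_of_premeasure[OF F(1) _ s] by metis
  have le_c: "w i powr s < c powr s" if "i \<in> I" for i
    using member_le_sum[OF that, of "\<lambda>i. w i powr s"] I(1) sum by simp
  obtain i where "i \<in> I"
    using I(2) F(2) by auto
  then have s_pos: "0 < s"
    using le_c[of i] w[of i] c(1) s by (cases "s = 0") auto
  have wc: "w i < c" if "i \<in> I" for i
    using le_c[OF that] powr_mono2[of s c "w i"] c(1) s by (force simp: not_less)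
  let ?f = "\<lambda>t. \<Sum>i\<in>I. (w i / a) powr t"
  have "?f s = (\<Sum>i\<in>I. w i powr s) / a powr s"
    using w a by (simp add: powr_divide less_imp_le sum_divide_distrib)
  also have "\<dots> < c powr s / a powr s"
    using sum a by (intro divide_strict_right_mono) auto
  also have "\<dots> \<le> 1"
    using c s a by (simp add: powr_mono2)
  finally have lt: "?f s < 1" .
  have "(?f \<longlongrightarrow> ?f s) (at_left s)"
    using w a by (intro tendsto_sum tendsto_powr tendsto_const tendsto_ident_at) force
  then have "eventually (\<lambda>t. ?f t < 1) (at_left s)"
    using lt by (rule order_tendstoD(2))
  moreover have "eventually (\<lambda>t. 0 < t \<and> t < s) (at_left s)"
    using s_pos by (auto simp: eventually_at_left_field)
  ultimately have "eventually (\<lambda>t. ?f t < 1 \<and> 0 < t \<and> t < s) (at_left s)"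
    by (rule eventually_conj)
  then obtain t where t: "?f t < 1" "0 < t" "t < s"
    using eventually_happens by fastforce
  have "\<exists>C>0. covering_growth F C t 1"
  proof (rule Q1_growth[OF Q1 a FX F I])
    show "0 < w i \<and> w i \<le> r0 \<and> w i < a \<and> spread_le (w i) (V i)" if "i \<in> I" for i
      using w[OF that] wc[OF that] c by auto
  qed (use t in auto)
  then have "assouad_dim X F \<le> ereal t"
    using Q1_assouad_dim_le[OF Q1 a r0 FX] by blast
  then show ?thesis
    using t(3) by (simp add: order_le_less_trans)
qed

lemma Q1_assouad_dim_le_hausdorff_dim:
  assumes "Q1 X F a r0" "0 < a" "0 < r0" "F \<subseteq> X" "compact F" "F \<noteq> {}"
  shows "assouad_dim X F \<le> hausdorff_dim F"
  unfolding hausdorff_dim_def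
  using Q1_assouad_dim_less[OF assms] by (intro Inf_greatest) (auto intro: less_imp_le)

section \<open>Balls that contain expanded copies of the whole set\<close>

lemma Q2_map:
  assumes "Q2 X F a r0" "c \<in> F" "0 < r" "r \<le> r0"
  obtains g where "g \<in> F \<rightarrow> cball c r \<inter> F" "expands (a * r) g F"
proof -
  have "\<exists>g \<in> F \<rightarrow> F \<inter> (cball c r \<inter> X). \<forall>x\<in>F. \<forall>y\<in>F. a * r * dist x y \<le> dist (g x) (g y)"
    using assms unfolding Q2_def by blast
  then obtain g where "g \<in> F \<rightarrow> F \<inter> (cball c r \<inter> X)"
    "\<forall>x\<in>F. \<forall>y\<in>F. a * r * dist x y \<le> dist (g x) (g y)"
    by blast
  then show ?thesis
    using that[of g] by (auto simp: expands_def)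
qed

text \<open>A cover with all \<open>w i < \<rho> / 3\<close> splits into disjoint subfamilies, one for each of the copies
  \<open>g x ` F\<close> of \<open>F\<close> near the points \<open>x\<close> of \<open>S\<close>. Pulled back to \<open>F\<close>, each of them is a cover with
  fewer sets, because there are at least two copies, and with \<open>w i\<close> divided by the expansion factor.
  The induction hypothesis bounds its content, and adding up the \<open>card S\<close> bounds recovers the claim. Only
  finite covers occur, so that no limit set or mass distribution has to be constructed.\<close>

lemma Q2_content_lower_bound:
  fixes I :: "'i set"
  assumes Q2: "Q2 X F a r0" and a: "0 < a" and F_ne: "F \<noteq> {}"
    and \<rho>: "0 < \<rho>" "\<rho> / 3 \<le> r0"
    and S: "finite S" "S \<subseteq> F" "pairwise (\<lambda>x y. \<rho> < dist x y) S" "2 \<le> card S"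
    and t: "0 \<le> t" and big: "1 \<le> real (card S) * (a * (\<rho> / 3)) powr t"
    and I: "finite I" and "F \<subseteq> (\<Union>i\<in>I. V i)"
    and "\<And>i. i \<in> I \<Longrightarrow> 0 < w i \<and> spread_le (w i) (V i)"
  shows "(\<rho> / 3) powr t \<le> (\<Sum>i\<in>I. w i powr t)"
  using I assms(13,14)
proof (induction I arbitrary: V w rule: finite_psubset_induct)
  case (psubset I)
  let ?\<kappa> = "a * (\<rho> / 3)"
  have \<kappa>: "0 < ?\<kappa>"
    using a \<rho> by simp
  show ?case
  proof (cases "\<exists>i\<in>I. \<rho> / 3 \<le> w i")
    case True
    then obtain i where i: "i \<in> I" "\<rho> / 3 \<le> w i"
      by blast
    have "(\<rho> / 3) powr t \<le> w i powr t"
      using i \<rho> t by (intro powr_mono2) auto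
    also have "\<dots> \<le> (\<Sum>i\<in>I. w i powr t)"
      using i(1) psubset.hyps by (intro member_le_sum) auto
    finally show ?thesis .
  next
    case False
    have "\<exists>g. g \<in> F \<rightarrow> cball x (\<rho> / 3) \<inter> F \<and> expands ?\<kappa> g F" if "x \<in> S" for x
      using Q2_map[OF Q2, of x "\<rho> / 3"] that S(2) \<rho> by (metis divide_pos_pos subsetD zero_less_numeral)
    then obtain g where g: "\<And>x. x \<in> S \<Longrightarrow> g x \<in> F \<rightarrow> cball x (\<rho> / 3) \<inter> F"
      "\<And>x. x \<in> S \<Longrightarrow> expands ?\<kappa> (g x) F"
      by metis
    define J where "J x = {i\<in>I. V i \<inter> g x ` F \<noteq> {}}" for x
    have fin_J: "finite (J x)" for x
      using psubset.hyps by (simp add: J_def)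
    \<comment> \<open>Two copies lie in balls of radius \<open>\<rho> / 3\<close> whose centres are more than \<open>\<rho>\<close> apart; a set
      meeting both would bridge a gap larger than \<open>\<rho> / 3\<close>.\<close>
    have disj: "J x \<inter> J y = {}" if xy: "x \<in> S" "y \<in> S" "x \<noteq> y" for x y
    proof (rule ccontr)
      assume "J x \<inter> J y \<noteq> {}"
      then obtain i p q where i: "i \<in> I" and p: "p \<in> V i" "p \<in> g x ` F" and q: "q \<in> V i" "q \<in> g y ` F"
        unfolding J_def by blast
      have "dist x p \<le> \<rho> / 3" "dist y q \<le> \<rho> / 3"
        using p q g(1)[OF xy(1)] g(1)[OF xy(2)] by auto
      moreover have "dist p q < \<rho> / 3"
        using psubset.prems(2)[OF i] p(1) q(1) False i by (force dest: spread_leD)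
      moreover have "dist x y \<le> dist x p + dist p q + dist y q"
        using dist_triangle[of x y p] dist_triangle[of p y q] by (simp add: dist_commute)
      moreover have "\<rho> < dist x y"
        using S(3) xy by (auto simp: pairwise_def)
      ultimately show False
        by linarith
    qed
    have J_cover: "F \<subseteq> (\<Union>i\<in>J x. F \<inter> g x -` V i)" if "x \<in> S" for x
    proof
      fix z assume z: "z \<in> F"
      then have "g x z \<in> F"
        using g(1)[OF that] by auto
      then obtain i where "i \<in> I" "g x z \<in> V i"
        using psubset.prems(1) by blast
      then show "z \<in> (\<Union>i\<in>J x. F \<inter> g x -` V i)"
        using z unfolding J_def by auto
    qed
    have J_ne: "J x \<noteq> {}" if "x \<in> S" for x
      using J_cover[OF that] F_ne by auto
    have J_psub: "J x \<subset> I" if x: "x \<in> S" for x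
    proof -
      obtain y where "y \<in> S" "y \<noteq> x"
        using S(1,4) by (metis One_nat_def card_le_Suc0_iff_eq not_less_eq_eq numeral_2_eq_2)
      then show ?thesis
        using disj[OF x, of y] J_ne[of y] unfolding J_def by blast
    qed
    have "?\<kappa> powr t * (\<rho> / 3) powr t \<le> (\<Sum>i\<in>J x. w i powr t)" if x: "x \<in> S" for x
    proof -
      have "(\<rho> / 3) powr t \<le> (\<Sum>i\<in>J x. (w i / ?\<kappa>) powr t)"
      proof (rule psubset.IH[OF J_psub[OF x] J_cover[OF x]])
        fix i assume "i \<in> J x"
        then have "0 < w i \<and> spread_le (w i) (V i)"
          using psubset.prems(2) by (simp add: J_def)
        then show "0 < w i / ?\<kappa> \<and> spread_le (w i / ?\<kappa>) (F \<inter> g x -` V i)"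
          using \<kappa> spread_le_preimage[OF g(2)[OF x] \<kappa>] divide_pos_pos by blast
      qed
      also have "\<dots> = (\<Sum>i\<in>J x. w i powr t) / ?\<kappa> powr t"
        unfolding sum_divide_distrib
      proof (rule sum.cong)
        fix i assume "i \<in> J x"
        then have "0 \<le> w i"
          using psubset.prems(2) by (auto simp: J_def less_imp_le)
        then show "(w i / ?\<kappa>) powr t = w i powr t / ?\<kappa> powr t"
          using \<kappa> by (intro powr_divide)
      qed simp
      finally have "(\<rho> / 3) powr t * ?\<kappa> powr t \<le> (\<Sum>i\<in>J x. w i powr t)"
        using \<kappa> a \<rho>(1) by (subst (asm) pos_le_divide_eq) auto
      then show ?thesis
        by (simp add: mult.commute)
    qed
    then have "(\<Sum>x\<in>S. ?\<kappa> powr t * (\<rho> / 3) powr t) \<le> (\<Sum>x\<in>S. \<Sum>i\<in>J x. w i powr t)"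
      by (rule sum_mono)
    also have "\<dots> = (\<Sum>i\<in>(\<Union>x\<in>S. J x). w i powr t)"
      using S(1) fin_J disj by (intro sum.UNION_disjoint[symmetric]) auto
    also have "\<dots> \<le> (\<Sum>i\<in>I. w i powr t)"
      using psubset.hyps by (intro sum_mono2) (auto simp: J_def)
    finally have "real (card S) * ?\<kappa> powr t * (\<rho> / 3) powr t \<le> (\<Sum>i\<in>I. w i powr t)"
      by (simp add: mult.assoc)
    moreover have "1 * (\<rho> / 3) powr t \<le> real (card S) * ?\<kappa> powr t * (\<rho> / 3) powr t"
      using big by (intro mult_right_mono) auto
    ultimately show ?thesis
      by simp
  qed
qed

lemma Q2_separated_card_le:
  assumes Q2: "Q2 X F a r0" and a: "0 < a" and F: "compact F" "F \<noteq> {}"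
    and \<rho>: "0 < \<rho>" "\<rho> / 3 \<le> r0" "a * (\<rho> / 3) < 1"
    and S: "finite S" "S \<subseteq> F" "pairwise (\<lambda>x y. \<rho> < dist x y) S"
    and t: "0 \<le> t" and zero: "hausdorff_measure t F = 0"
  shows "real (card S) \<le> (a * (\<rho> / 3)) powr (- t)"
proof (rule ccontr)
  let ?\<kappa> = "a * (\<rho> / 3)"
  have \<kappa>: "0 < ?\<kappa>"
    using a \<rho> by simp
  assume "\<not> ?thesis"
  then have gt: "?\<kappa> powr (- t) < real (card S)"
    by simp
  have "1 \<le> ?\<kappa> powr (- t)"
    using powr_mono'[of "- t" 0 ?\<kappa>] \<kappa> a \<rho> t by simp
  then have "2 \<le> card S"
    using gt by simp
  moreover have "?\<kappa> powr (- t) * ?\<kappa> powr t \<le> real (card S) * ?\<kappa> powr t"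
    using gt by (intro mult_right_mono) auto
  then have "1 \<le> real (card S) * ?\<kappa> powr t"
    using \<kappa> a \<rho>(1) by (simp add: powr_add[symmetric])
  moreover have "hausdorff_premeasure t 1 F < ennreal ((\<rho> / 3) powr t)"
    using hausdorff_premeasure_le_measure[of 1 t F] zero \<rho>(1) by simp
  then obtain I :: "nat set" and V w where "finite I" "F \<subseteq> (\<Union>i\<in>I. V i)"
    "\<And>i. i \<in> I \<Longrightarrow> 0 < w i \<and> spread_le (w i) (V i)" "(\<Sum>i\<in>I. w i powr t) < (\<rho> / 3) powr t"
    using finite_cover_of_premeasure[OF F(1) _ t] by metis
  ultimately show False
    using Q2_content_lower_bound[OF Q2 a F(2) \<rho>(1,2) S _ t, of I V w] by auto
qed

text \<open>A maximal set of points at mutual distances above \<open>r / 2\<close> yields a cover by sets of diameter at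
  most \<open>r\<close>. The base \<open>6 / a\<close> and the range of scales are the same for all \<open>t\<close>, on which the finiteness
  of the critical measure rests.\<close>

lemma Q2_growth:
  assumes Q2: "Q2 X F a r0" and a: "0 < a" and F: "compact F" "F \<noteq> {}"
    and t: "0 \<le> t" and zero: "hausdorff_measure t F = 0"
  shows "covering_growth F ((6 / a) powr t) t (min (6 * r0) (6 / a))"
  unfolding covering_growth_def
proof (intro allI impI, elim conjE)
  fix r assume r: "0 < r" "r < min (6 * r0) (6 / a)"
  let ?\<rho> = "r / 2"
  have \<rho>: "0 < ?\<rho>" "?\<rho> / 3 \<le> r0" "a * (?\<rho> / 3) < 1"
    using r a by (auto simp: field_simps)
  obtain m :: nat where m: "(a * (?\<rho> / 3)) powr (- t) < real m"
    using reals_Archimedean2 by blast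
  obtain S where S: "S \<subseteq> F" "finite S" "pairwise (\<lambda>x y. ?\<rho> < dist x y) S"
    "card S = m \<or> F \<subseteq> (\<Union>x\<in>S. cball x ?\<rho>)"
    using separated_net[of ?\<rho> F m] \<rho>(1) by auto
  have card: "real (card S) \<le> (a * (?\<rho> / 3)) powr (- t)"
    by (rule Q2_separated_card_le[OF Q2 a F \<rho> S(2,1,3) t zero])
  then have "coverable F (2 * ?\<rho>) (card S)"
    using m S by (intro coverable_centres) auto
  moreover have "(a * (?\<rho> / 3)) powr (- t) = (6 / a) powr t * r powr (- t)"
    using a r by (simp add: powr_mult powr_divide powr_minus field_simps)
  ultimately show "\<exists>n. coverable F r n \<and> real n \<le> (6 / a) powr t * r powr (- t)"
    using card by (intro exI[of _ "card S"]) simp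
qed

lemma Q2_upper_box_dim_le_hausdorff_dim:
  assumes "Q2 X F a r0" "0 < a" "0 < r0" "compact X" "F \<subseteq> X" "compact F" "F \<noteq> {}"
  shows "upper_box_dim X F \<le> hausdorff_dim F"
  unfolding hausdorff_dim_def
proof (rule Inf_greatest, clarify)
  fix t :: real assume "0 \<le> t" "hausdorff_measure t F = 0"
  from Q2_growth[OF assms(1,2,6,7) this] show "upper_box_dim X F \<le> ereal t"
    by (rule upper_box_dim_le_growth[OF assms(4-7)]) (use assms(2,3) in simp)
qed

text \<open>The map from \<open>F\<close> into the ball of radius \<open>R\<close> expands by \<open>a R\<close>, so a cover of the ball at scale \<open>r\<close>
  pulls back to a cover of \<open>F\<close> at scale \<open>r / (a R)\<close>. If this scale is small, the power law for \<open>F\<close>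
  applies; otherwise \<open>R / r\<close> is bounded and one covering set suffices for the lower bound.\<close>

lemma Q2_lower_box_dim_le_lower_dim:
  assumes Q2: "Q2 X F a r0" and a: "0 < a" and r0: "0 < r0"
    and X: "compact X" and FX: "F \<subseteq> X" and F: "compact F" "F \<noteq> {}"
  shows "lower_box_dim X F \<le> lower_dim X F"
proof (rule ereal_le_by_real_below)
  fix \<alpha> assume "ereal \<alpha> < lower_box_dim X F"
  then obtain d where d: "0 < d" "\<And>r. 0 < r \<Longrightarrow> r < d \<Longrightarrow> r powr (- \<alpha>) \<le> real (covering_number X r F)"
    using covering_number_if_lower_box_dim_greater[OF X FX F] by blast
  \<comment> \<open>Bounds \<open>(R / r) powr \<alpha>\<close> when \<open>R / r\<close> lies between \<open>1\<close> and \<open>2 / (a d)\<close>, for either sign of \<open>\<alpha>\<close>.\<close>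
  define M where "M = max 1 ((2 / (a * d)) powr \<alpha>)"
  define C where "C = min ((a / 2) powr \<alpha>) (1 / M)"
  have M: "1 \<le> M"
    by (simp add: M_def)
  have C: "0 < C" "C \<le> (a / 2) powr \<alpha>" "C * M \<le> 1"
    using a M by (auto simp: C_def min_def field_simps)
  have "ereal (C * (R / r) powr \<alpha>) \<le> (INF x\<in>F. ereal (covering_number X r (cball x R \<inter> F)))"
    if r: "0 < r" "r < R" "R \<le> r0" for r R
  proof (rule INF_greatest)
    fix x assume x: "x \<in> F"
    let ?N = "covering_number X r (cball x R \<inter> F)" and ?q = "2 * (r / (a * R))"
    have q: "0 < ?q"
      using r a by simp
    obtain g where g: "g \<in> F \<rightarrow> cball x R \<inter> F" "expands (a * R) g F"
      using Q2_map[OF Q2 x, of R] r by auto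
    have "coverable (cball x R \<inter> F) r ?N"
      using FX by (intro coverable_covering_number[OF X _ r(1)]) auto
    then have "coverable F (r / (a * R)) ?N"
      using r a by (intro coverable_preimage[OF g(2,1)]) auto
    then have le: "covering_number X ?q F \<le> ?N"
      using r a by (intro covering_number_le[OF FX]) auto
    have "C * (R / r) powr \<alpha> \<le> real ?N"
    proof (cases "?q < d")
      case True
      have "C * (R / r) powr \<alpha> \<le> (a / 2) powr \<alpha> * (R / r) powr \<alpha>"
        using C(2) by (intro mult_right_mono) auto
      also have "\<dots> = ?q powr (- \<alpha>)"
        using a r by (simp add: powr_mult powr_divide powr_minus field_simps)
      also have "\<dots> \<le> real ?N"
        using d(2)[OF q True] le by linarith
      finally show ?thesis .
    next
      case False
      then have Rr: "1 \<le> R / r" "R / r \<le> 2 / (a * d)"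
        using a r d(1) by (auto simp: field_simps)
      have "(R / r) powr \<alpha> \<le> M"
      proof (cases "0 \<le> \<alpha>")
        case True
        then have "(R / r) powr \<alpha> \<le> (2 / (a * d)) powr \<alpha>"
          using Rr by (intro powr_mono2) auto
        then show ?thesis
          by (simp add: M_def)
      next
        case False
        then have "(R / r) powr \<alpha> \<le> (R / r) powr 0"
          using Rr(1) by (intro powr_mono) auto
        then show ?thesis
          using r M by simp
      qed
      then have "C * (R / r) powr \<alpha> \<le> C * M"
        using C(1) by (intro mult_left_mono) auto
      moreover have "1 \<le> ?N"
      proof (rule covering_number_ge_1[OF X _ r(1)])
        show "cball x R \<inter> F \<noteq> {}"
          using x r by (force simp: disjoint_iff)
      qed (use FX in auto)
      ultimately show ?thesis
        using C(3) by linarith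
    qed
    then show "ereal (C * (R / r) powr \<alpha>) \<le> ereal ?N"
      by simp
  qed
  then show "ereal \<alpha> \<le> lower_dim X F"
    unfolding lower_dim_def using C(1) r0 by (intro Sup_upper imageI) blast
qed

text \<open>At each scale \<open>r\<close>, \<open>F\<close> has \<open>s\<close>-content at most \<open>(6 / a) powr t * r powr (s - t)\<close> for exponents \<open>t\<close>
  arbitrarily close to \<open>s\<close>. Letting \<open>t\<close> tend to \<open>s\<close> for fixed \<open>r\<close> gives a bound that holds for all
  small \<open>r\<close>.\<close>

lemma Q2_hausdorff_measure_finite:
  assumes Q2: "Q2 X F a r0" and a: "0 < a" and r0: "0 < r0" and F: "compact F" "F \<noteq> {}"
    and dim: "hausdorff_dim F = ereal s" and s: "0 \<le> s"
  shows "hausdorff_measure s F < top"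
proof -
  let ?B = "(6 / a) powr s + 1"
  have "hausdorff_premeasure s d F \<le> ennreal ?B" if d: "0 < d" for d
  proof -
    define r where "r = min d (min (6 * r0) (6 / a) / 2)"
    have r: "0 < r" "r \<le> d" "r < min (6 * r0) (6 / a)"
      using d a r0 unfolding r_def min_def by (auto simp: field_simps)
    let ?f = "\<lambda>t. (6 / a) powr t * r powr (s - t)"
    have "(?f \<longlongrightarrow> ?f s) (at_right s)"
      using a r by (intro tendsto_intros) auto
    then have "eventually (\<lambda>t. ?f t < ?B) (at_right s)"
      using r by (intro order_tendstoD(2)) auto
    then obtain b where b: "s < b" "\<And>t. s < t \<Longrightarrow> t < b \<Longrightarrow> ?f t < ?B"
      unfolding eventually_at_right_field by auto
    have "hausdorff_dim F < ereal b"
      using dim b(1) by simp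
    then obtain t where t: "0 \<le> t" "hausdorff_measure t F = 0" "t < b"
      unfolding hausdorff_dim_def Inf_less_iff by auto
    then have "hausdorff_dim F \<le> ereal t"
      unfolding hausdorff_dim_def by (intro Inf_lower) auto
    then have "s \<le> t"
      using dim by simp
    then have f: "?f t \<le> ?B"
      using b(2)[of t] t(3) r(1) by (cases "t = s") auto
    obtain n where n: "coverable F r n" "real n \<le> (6 / a) powr t * r powr (- t)"
      using Q2_growth[OF Q2 a F t(1,2)] r unfolding covering_growth_def by blast
    have "hausdorff_premeasure s d F \<le> hausdorff_premeasure s r F"
      by (rule hausdorff_premeasure_antimono[OF r(2)])
    also have "\<dots> \<le> ennreal (real n * r powr s)"
      by (rule hausdorff_premeasure_le_coverable[OF n(1) r(1) s])
    also have "\<dots> \<le> ennreal ?B"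
    proof (rule ennreal_leI)
      have "real n * r powr s \<le> (6 / a) powr t * r powr (- t) * r powr s"
        using n(2) by (intro mult_right_mono) auto
      also have "\<dots> = ?f t"
        by (simp add: mult.assoc powr_add[symmetric])
      finally show "real n * r powr s \<le> ?B"
        using f by simp
    qed
    finally show ?thesis .
  qed
  then have "hausdorff_measure s F \<le> ennreal ?B"
    unfolding hausdorff_measure_def by (intro SUP_least) auto
  then show ?thesis
    by (rule order_le_less_trans) simp
qed

section \<open>Ahlfors regularity\<close>

text \<open>With \<open>s\<close> the Hausdorff dimension, \<^const>\<open>Q1\<close> expands a ball of radius \<open>r\<close> by \<open>a / (2 r)\<close> into \<open>F\<close> and
  bounds its measure from above, and \<^const>\<open>Q2\<close> expands \<open>F\<close> by \<open>a r\<close> into the ball and bounds it from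
  below. For larger radii, which stay below the diameter, comparison with \<open>F\<close> itself and with the ball
  of radius \<open>r0\<close> changes only the constants.\<close>

lemma Q1_Q2_ahlfors_regular:
  assumes Q1: "Q1 X F a r0" and Q2: "Q2 X F a r0" and a: "0 < a" and r0: "0 < r0"
    and X: "compact X" and FX: "F \<subseteq> X" and F: "compact F" "F \<noteq> {}"
  shows "ahlfors_regular F"
proof -
  have le: "hausdorff_dim F \<le> assouad_dim X F"
    using hausdorff_dim_le_lower_box_dim[OF X FX F] lower_box_dim_le_upper
      upper_box_dim_le_assouad_dim[OF X FX F] order_trans by metis
  then have fin: "hausdorff_dim F < \<infinity>"
    using Q1_assouad_dim_finite[OF Q1 a r0 FX F] by (rule order_le_less_trans)
  have nonneg: "0 \<le> hausdorff_dim F"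
    unfolding hausdorff_dim_def by (intro Inf_greatest) auto
  define s where "s = real_of_ereal (hausdorff_dim F)"
  have dim: "hausdorff_dim F = ereal s" and s: "0 \<le> s"
    using fin nonneg unfolding s_def by (cases "hausdorff_dim F"; simp)+
  have "hausdorff_measure s F \<noteq> 0"
    using Q1_assouad_dim_less[OF Q1 a r0 FX F s] le dim by auto
  moreover have "hausdorff_measure s F < top"
    by (rule Q2_hausdorff_measure_finite[OF Q2 a r0 F dim s])
  ultimately obtain h where h: "hausdorff_measure s F = ennreal h" "0 < h"
    by (cases "hausdorff_measure s F" rule: ennreal_cases) (auto simp: less_le)
  define D where "D = diameter F"
  have upper: "hausdorff_measure s (cball x r \<inter> F) \<le> ennreal (h * ((2 / a) powr s + (2 / r0) powr s) * r powr s)"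
    if r: "0 < r" for x r
  proof (cases "2 * r \<le> r0")
    case True
    obtain g where g: "g \<in> cball x r \<inter> F \<rightarrow> F" "expands (a / (2 * r)) g (cball x r \<inter> F)"
      using Q1_map[OF Q1 a FX _ spread_le_cball[of r x F]] r True by auto
    have "ennreal ((a / (2 * r)) powr s) * hausdorff_measure s (cball x r \<inter> F) \<le> ennreal h"
      using hausdorff_measure_expands[OF g(2,1) _ s] a r h(1) by simp
    then have "ennreal ((2 * r / a) powr s) * (ennreal ((a / (2 * r)) powr s) * hausdorff_measure s (cball x r \<inter> F))
        \<le> ennreal ((2 * r / a) powr s) * ennreal h"
      by (rule mult_left_mono) simp
    moreover have "(2 * r / a) powr s * (a / (2 * r)) powr s = 1"
      using a r by (simp flip: powr_mult)
    ultimately have "hausdorff_measure s (cball x r \<inter> F) \<le> ennreal ((2 * r / a) powr s * h)"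
      using h(2) by (simp flip: mult.assoc ennreal_mult)
    also have "\<dots> \<le> ennreal (h * ((2 / a) powr s + (2 / r0) powr s) * r powr s)"
    proof (rule ennreal_leI)
      have "(2 * r / a) powr s = (2 / a) powr s * r powr s"
        using a r by (simp flip: powr_mult)
      then show "(2 * r / a) powr s * h \<le> h * ((2 / a) powr s + (2 / r0) powr s) * r powr s"
        using h(2) by (simp add: algebra_simps)
    qed
    finally show ?thesis .
  next
    case False
    have "hausdorff_measure s (cball x r \<inter> F) \<le> ennreal h"
      using hausdorff_measure_mono[of "cball x r \<inter> F" F s] h(1) by simp
    also have "\<dots> \<le> ennreal (h * ((2 / a) powr s + (2 / r0) powr s) * r powr s)"
    proof (rule ennreal_leI)
      have "1 \<le> (2 * r / r0) powr s"
        using False r0 s by (intro ge_one_powr_ge_zero) (auto simp: field_simps)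
      also have "(2 * r / r0) powr s = (2 / r0) powr s * r powr s"
        using r0 r by (simp flip: powr_mult)
      finally have "h * 1 \<le> h * ((2 / r0) powr s * r powr s)"
        using h(2) by (intro mult_left_mono) auto
      also have "\<dots> \<le> h * ((2 / a) powr s + (2 / r0) powr s) * r powr s"
        using h(2) by (simp add: algebra_simps)
      finally show "h \<le> h * ((2 / a) powr s + (2 / r0) powr s) * r powr s"
        by simp
    qed
    finally show ?thesis .
  qed
  \<comment> \<open>\<open>r * k \<le> min r r0\<close> for \<open>r < D\<close>, so one constant covers the radii below and above \<open>r0\<close>.\<close>
  define k where "k = min 1 (r0 / D)"
  have lower: "ennreal (h * (a * k) powr s * r powr s) \<le> hausdorff_measure s (cball x r \<inter> F)"
    if x: "x \<in> F" and r: "0 < r" "r < D" for x r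
  proof -
    let ?r = "min r r0"
    have k: "0 < k" "r * k \<le> ?r"
    proof -
      show "0 < k"
        using r r0 by (simp add: k_def)
      have "r * k \<le> r * 1" "r * k \<le> D * (r0 / D)"
        using r r0 by (intro mult_mono; simp add: k_def)+
      then show "r * k \<le> ?r"
        using r by simp
    qed
    obtain g where g: "g \<in> F \<rightarrow> cball x ?r \<inter> F" "expands (a * ?r) g F"
      using Q2_map[OF Q2 x, of ?r] r r0 by auto
    have "ennreal (h * (a * k) powr s * r powr s) = ennreal ((a * (r * k)) powr s * h)"
      using a r k by (simp add: powr_mult mult_ac)
    also have "\<dots> \<le> ennreal ((a * ?r) powr s * h)"
      using a r k h(2) s by (intro ennreal_leI mult_right_mono powr_mono2 mult_left_mono) auto
    also have "\<dots> = ennreal ((a * ?r) powr s) * hausdorff_measure s F"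
      using h by (simp add: ennreal_mult)
    also have "\<dots> \<le> hausdorff_measure s (cball x ?r \<inter> F)"
      using a r r0 by (intro hausdorff_measure_expands[OF g(2,1) _ s]) auto
    also have "\<dots> \<le> hausdorff_measure s (cball x r \<inter> F)"
      by (intro hausdorff_measure_mono) auto
    finally show ?thesis .
  qed
  define c1 where "c1 = h * ((2 / a) powr s + (2 / r0) powr s)"
  define c2 where "c2 = h * (a * k) powr s"
  have "0 < c1"
    using h(2) a r0 by (auto simp: c1_def intro!: mult_pos_pos add_pos_pos)
  have "0 \<le> c2"
    using h(2) by (simp add: c2_def)
  \<comment> \<open>If \<open>F\<close> is a single point then \<open>D = 0\<close> and \<open>c2\<close> may vanish; \<open>inverse 0 = 0\<close> still makes \<open>c\<close> positive.\<close>
  define c where "c = c1 + inverse c2"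
  have c: "0 < c" "c1 \<le> c"
    using \<open>0 < c1\<close> \<open>0 \<le> c2\<close> by (auto simp: c_def add_pos_nonneg)
  have "ennreal (inverse c * r powr s) \<le> hausdorff_measure s (cball x r \<inter> F) \<and>
      hausdorff_measure s (cball x r \<inter> F) \<le> ennreal (c * r powr s)"
    if x: "x \<in> F" and r: "0 < r" "r < D" for x r
  proof
    have "0 < k"
      using r r0 by (simp add: k_def)
    then have "0 < c2"
      using h(2) a by (simp add: c2_def)
    then have "inverse c \<le> inverse (inverse c2)"
      using \<open>0 < c1\<close> by (intro le_imp_inverse_le) (auto simp: c_def)
    then have "ennreal (inverse c * r powr s) \<le> ennreal (c2 * r powr s)"
      by (intro ennreal_leI mult_right_mono) auto
    also have "\<dots> \<le> hausdorff_measure s (cball x r \<inter> F)"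
      unfolding c2_def by (rule lower[OF x r])
    finally show "ennreal (inverse c * r powr s) \<le> hausdorff_measure s (cball x r \<inter> F)" .
    have "hausdorff_measure s (cball x r \<inter> F) \<le> ennreal (c1 * r powr s)"
      unfolding c1_def by (rule upper[OF r(1)])
    also have "\<dots> \<le> ennreal (c * r powr s)"
      using c(2) by (intro ennreal_leI mult_right_mono) auto
    finally show "hausdorff_measure s (cball x r \<inter> F) \<le> ennreal (c * r powr s)" .
  qed
  then show ?thesis
    unfolding ahlfors_regular_def Let_def s_def[symmetric] D_def[symmetric]
    using F(1) fin c(1) by blast
qed

section \<open>Equality of the dimensions\<close>

theorem theorem2p10:
  fixes X F :: "'a::metric_space set"
  assumes "compact X" and "F \<subseteq> X" and "compact F" and "F \<noteq> {}"
  shows "((\<exists>a>0. \<exists>r0>0. Q1 X F a r0) \<longrightarrow>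
            lower_dim X F \<le> hausdorff_dim F \<and>
            hausdorff_dim F = packing_dim X F \<and>
            packing_dim X F = lower_box_dim X F \<and>
            lower_box_dim X F = upper_box_dim X F \<and>
            upper_box_dim X F = assouad_dim X F)
       \<and> ((\<exists>a>0. \<exists>r0>0. Q2 X F a r0) \<longrightarrow>
            lower_dim X F = hausdorff_dim F \<and>
            hausdorff_dim F = packing_dim X F \<and>
            packing_dim X F = lower_box_dim X F \<and>
            lower_box_dim X F = upper_box_dim X F \<and>
            upper_box_dim X F \<le> assouad_dim X F)
       \<and> ((\<exists>a>0. \<exists>r0>0. Q1 X F a r0 \<and> Q2 X F a r0) \<longrightarrow>
            lower_dim X F = hausdorff_dim F \<and>
            hausdorff_dim F = packing_dim X F \<and>
            packing_dim X F = lower_box_dim X F \<and>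
            lower_box_dim X F = upper_box_dim X F \<and>
            upper_box_dim X F = assouad_dim X F \<and>
            ahlfors_regular F)"
proof -
  note general = lower_dim_le_lower_box_dim[OF assms] hausdorff_dim_le_lower_box_dim[OF assms]
    lower_box_dim_le_upper[of X F] hausdorff_dim_le_packing_dim[of F X]
    packing_dim_le_upper_box_dim[OF assms] upper_box_dim_le_assouad_dim[OF assms]
  have 1: "lower_dim X F \<le> hausdorff_dim F \<and> hausdorff_dim F = packing_dim X F \<and>
      packing_dim X F = lower_box_dim X F \<and> lower_box_dim X F = upper_box_dim X F \<and>
      upper_box_dim X F = assouad_dim X F" if "Q1 X F a r0" "0 < a" "0 < r0" for a r0
    using Q1_assouad_dim_le_hausdorff_dim[OF that assms(2-4)] general by auto
  have 2: "lower_dim X F = hausdorff_dim F \<and> hausdorff_dim F = packing_dim X F \<and>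
      packing_dim X F = lower_box_dim X F \<and> lower_box_dim X F = upper_box_dim X F \<and>
      upper_box_dim X F \<le> assouad_dim X F" if "Q2 X F a r0" "0 < a" "0 < r0" for a r0
    using Q2_upper_box_dim_le_hausdorff_dim[OF that assms]
      Q2_lower_box_dim_le_lower_dim[OF that assms] general by auto
  show ?thesis
    using 1 2 Q1_Q2_ahlfors_regular[OF _ _ _ _ assms] by metis
qed

end
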